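(* Let $\sigma$ and $\tau$ be (possibly empty) non-crossing partitions, and let $\rho,\rho'$ be cc-equivalent non-crossing partitions. Then $\sigma[\rho][\tau]$ and $\sigma[\rho'][\tau]$ are cc-equivalent.
   Context: Set partitions are written in canonical sequential form (restricted growth words). A partition is non-crossing if it avoids the pattern $1212$ (pattern containment = having a subsequence order-isomorphic to the pattern). For partitions $\alpha,\beta$, $\alpha[\beta]$ is the concatenation of $\alpha$ with $\beta+r$, $r$ the number of blocks of $\alpha$ ($\beta+r$ adds $r$ to every letter); this is associative. A partition $\pi$ is connected if it cannot be written as $\alpha[\beta]$ with $\alpha,\beta$ nonempty; every partition is uniquely $\pi=\sigma_1[\sigma_2]\cdots[\sigma_m]$ with nonempty connected $\sigma_i$, its components. Two non-crossing patterns $\sigma,\tau$ are cc-equivalent if there is a bijection from the set of partitions avoiding both $1212$ and $\sigma$ to the set of partitions avoiding both $1212$ and $\tau$ that preserves size and number of components. *)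

theory Defs
  imports Main "HOL-Library.Sublist"
begin

text \<open>Set partitions in canonical sequential form (restricted growth words), letters start at 1.\<close>
definition is_partition :: "nat list \<Rightarrow> bool" where
  "is_partition w \<longleftrightarrow>
     (\<forall>i < length w. 1 \<le> w ! i \<and> w ! i \<le> Suc (Max (insert 0 (set (take i w)))))"

definition nblocks :: "nat list \<Rightarrow> nat" where
  "nblocks w = Max (insert 0 (set w))"

definition order_iso :: "nat list \<Rightarrow> nat list \<Rightarrow> bool" where
  "order_iso s p \<longleftrightarrow> length s = length p \<and>
     (\<forall>a < length p. \<forall>b < length p. (s ! a \<le> s ! b) \<longleftrightarrow> (p ! a \<le> p ! b))"

definition contains :: "nat list \<Rightarrow> nat list \<Rightarrow> bool" where
  "contains w p \<longleftrightarrow> (\<exists>s. subseq s w \<and> order_iso s p)"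

definition noncrossing :: "nat list \<Rightarrow> bool" where
  "noncrossing w \<longleftrightarrow> is_partition w \<and> \<not> contains w [1,2,1,2]"

definition pcomp :: "nat list \<Rightarrow> nat list \<Rightarrow> nat list" where
  "pcomp \<alpha> \<beta> = \<alpha> @ map (\<lambda>x. x + nblocks \<alpha>) \<beta>"

definition connected_part :: "nat list \<Rightarrow> bool" where
  "connected_part \<pi> \<longleftrightarrow> \<pi> \<noteq> [] \<and>
     \<not> (\<exists>\<alpha> \<beta>. is_partition \<alpha> \<and> is_partition \<beta> \<and> \<alpha> \<noteq> [] \<and> \<beta> \<noteq> [] \<and> \<pi> = pcomp \<alpha> \<beta>)"

text \<open>Number of components: the length m of the (unique) decomposition
  pi = sigma_1[sigma_2]...[sigma_m] into nonempty connected partitions.\<close>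
definition ncomp :: "nat list \<Rightarrow> nat" where
  "ncomp \<pi> = (THE m. \<exists>cs. length cs = m \<and> (\<forall>c \<in> set cs. is_partition c \<and> connected_part c)
                        \<and> foldl pcomp [] cs = \<pi>)"

definition Av_nc :: "nat list \<Rightarrow> nat list set" where
  "Av_nc p = {\<pi>. is_partition \<pi> \<and> \<not> contains \<pi> [1,2,1,2] \<and> \<not> contains \<pi> p}"

definition cc_equiv :: "nat list \<Rightarrow> nat list \<Rightarrow> bool" where
  "cc_equiv \<sigma> \<tau> \<longleftrightarrow> (\<exists>f. bij_betw f (Av_nc \<sigma>) (Av_nc \<tau>) \<and>
     (\<forall>\<pi> \<in> Av_nc \<sigma>. length (f \<pi>) = length \<pi> \<and> ncomp (f \<pi>) = ncomp \<pi>))"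

end

theory Submission
  imports Defs
begin

text \<open>
  Reading a non-crossing partition from left to right, the letters that may still recur form a
  stack: a letter is legal iff it is a new maximum or lies on the stack, and it then closes
  everything above it. The final height of the stack is the number of components.

  For \<open>\<sigma>[\<rho>]\<close>, let \<open>P\<close> be the shortest prefix of \<open>\<pi> = P S\<close> that contains \<open>\<sigma>\<close>. By non-crossingness,
  \<open>\<pi>\<close> contains \<open>\<sigma>[\<rho>]\<close> iff the letters of \<open>S\<close> exceeding all of \<open>P\<close> contain \<open>\<rho>\<close>. These letters form a
  non-crossing partition \<open>q\<close>, and the remaining letters of \<open>S\<close> can only be placed in the gaps
  between components of \<open>q\<close>; hence \<open>q\<close> can be replaced by any other partition with as many
  components.

  For \<open>\<rho>[\<tau>]\<close>, let \<open>n\<close> be maximal such that the letters \<open>> n\<close> of \<open>\<pi>\<close> contain \<open>\<tau>\<close>, and let \<open>Q\<close> be the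
  prefix of \<open>\<pi>\<close> before the first \<open>n + 1\<close>. Then \<open>\<pi>\<close> contains \<open>\<rho>[\<tau>]\<close> iff \<open>Q\<close> contains \<open>\<rho>\<close>, and the
  continuations of \<open>Q\<close> depend, up to an increasing renaming, only on the stack height of \<open>Q\<close>, that
  is, on its number of components.
\<close>


section \<open>Partitions and pattern containment\<close>

lemma nblocks_Nil [simp]: "nblocks [] = 0"
  by (simp add: nblocks_def)

lemma nblocks_append [simp]: "nblocks (v @ w) = max (nblocks v) (nblocks w)"
proof -
  have "insert 0 (set (v @ w)) = insert 0 (set v) \<union> insert 0 (set w)" by auto
  then show ?thesis
    unfolding nblocks_def by (metis Max_Un List.finite_set finite_insert insert_not_empty)
qed

lemma nblocks_single [simp]: "nblocks [x] = x"
  by (simp add: nblocks_def)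

lemma nblocks_Cons [simp]: "nblocks (x # w) = max x (nblocks w)"
  using nblocks_append[of "[x]" w] by simp

lemma le_nblocks: "x \<in> set w \<Longrightarrow> x \<le> nblocks w"
  by (simp add: nblocks_def)

lemma nblocks_in_set: "w \<noteq> [] \<Longrightarrow> nblocks w \<in> set w"
proof (induction w)
  case (Cons x w)
  then show ?case by (cases "w = []") (auto simp: max_def)
qed simp

lemma nblocks_map_add: "w \<noteq> [] \<Longrightarrow> nblocks (map (\<lambda>x. x + n) w) = nblocks w + n"
proof (induction w)
  case (Cons x w)
  then show ?case by (cases "w = []") auto
qed simp

lemma is_partition_Nil [simp]: "is_partition []"
  by (simp add: is_partition_def)

lemma is_partition_snoc:
  "is_partition (w @ [x]) \<longleftrightarrow> is_partition w \<and> 1 \<le> x \<and> x \<le> Suc (nblocks w)"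
  unfolding is_partition_def nblocks_def by (auto simp: nth_append less_Suc_eq)

lemma is_partition_appendD: "is_partition (v @ w) \<Longrightarrow> is_partition v"
  by (induction w rule: rev_induct) (simp_all add: is_partition_snoc flip: append_assoc)

lemma is_partition_pos: "is_partition w \<Longrightarrow> x \<in> set w \<Longrightarrow> 0 < x"
  by (induction w rule: rev_induct) (auto simp: is_partition_snoc)

lemma is_partition_surj:
  "is_partition w \<Longrightarrow> 1 \<le> x \<Longrightarrow> x \<le> nblocks w \<Longrightarrow> x \<in> set w"
  by (induction w rule: rev_induct) (auto simp: is_partition_snoc le_Suc_eq max_def split: if_splits)

lemma is_partition_hd: "is_partition (x # w) \<Longrightarrow> x = 1"
  using is_partition_appendD[of "[x]" w] is_partition_snoc[of "[]" x] by simp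

lemma is_partition_smaller_before:
  assumes "is_partition (u @ y # v)" "1 \<le> x" "x < y"
  shows "x \<in> set u"
proof -
  have "is_partition (u @ [y])" using is_partition_appendD[of "u @ [y]" v] assms by simp
  then show ?thesis using assms is_partition_surj[of u x] by (simp add: is_partition_snoc)
qed

lemma is_partition_append_shift:
  assumes "is_partition v" "\<forall>x\<in>set w. 0 < x"
  shows "is_partition (v @ map (\<lambda>x. x + nblocks v) w) \<longleftrightarrow> is_partition w"
  using assms(2)
proof (induction w rule: rev_induct)
  case (snoc x w)
  have "nblocks (v @ map (\<lambda>x. x + nblocks v) w) = nblocks w + nblocks v"
    by (cases "w = []") (simp_all add: nblocks_map_add)
  then show ?case using snoc
    by (simp add: is_partition_snoc del: nblocks_append append_assoc
      flip: append_assoc)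
qed (simp add: assms(1))

lemma order_iso_appendD:
  assumes "order_iso (s @ t) (p @ q)" "length s = length p"
  shows "order_iso s p" "order_iso t q"
    "x \<in> set s \<Longrightarrow> y \<in> set t \<Longrightarrow> \<forall>a\<in>set p. \<forall>b\<in>set q. a < b \<Longrightarrow> x < y"
proof -
  have len: "length t = length q" using assms by (simp add: order_iso_def)
  have iso: "((s @ t) ! a \<le> (s @ t) ! b) = ((p @ q) ! a \<le> (p @ q) ! b)"
    if "a < length p + length q" "b < length p + length q" for a b
    using assms that by (simp add: order_iso_def)
  show "order_iso s p"
    unfolding order_iso_def
  proof (intro conjI allI impI)
    fix a b assume "a < length p" "b < length p"
    then show "(s ! a \<le> s ! b) = (p ! a \<le> p ! b)"
      using iso[of a b] assms(2) by (simp add: nth_append)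
  qed (fact assms(2))
  show "order_iso t q"
    unfolding order_iso_def
  proof (intro conjI allI impI)
    fix a b assume "a < length q" "b < length q"
    then show "(t ! a \<le> t ! b) = (q ! a \<le> q ! b)"
      using iso[of "length p + a" "length p + b"] assms(2) by (simp add: nth_append)
  qed (fact len)
  assume "x \<in> set s" "y \<in> set t" and less: "\<forall>a\<in>set p. \<forall>b\<in>set q. a < b"
  then obtain i j where ij: "i < length s" "x = s ! i" "j < length t" "y = t ! j"
    by (auto simp: in_set_conv_nth)
  then have "p ! i < q ! j" using less len assms(2) by auto
  then show "x < y"
    using iso[of "length p + j" i] ij len assms(2) by (simp add: nth_append)
qed

lemma order_iso_appendI:
  assumes "order_iso s p" "order_iso t q"
    and "\<forall>a\<in>set s. \<forall>b\<in>set t. a < b" "\<forall>a\<in>set p. \<forall>b\<in>set q. a < b"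
  shows "order_iso (s @ t) (p @ q)"
proof -
  have len: "length s = length p" "length t = length q"
    using assms by (simp_all add: order_iso_def)
  have 1: "s ! i < t ! j" "p ! i < q ! j" if "i < length p" "j < length q" for i j
    using that assms(3,4) len by auto
  show ?thesis
    unfolding order_iso_def
  proof (intro conjI allI impI)
    fix a b assume "a < length (p @ q)" "b < length (p @ q)"
    then have *: "a < length p \<or> a - length p < length q" "b < length p \<or> b - length p < length q"
      by auto
    show "((s @ t) ! a \<le> (s @ t) ! b) = ((p @ q) ! a \<le> (p @ q) ! b)"
      using assms(1,2) 1[of a "b - length p"] 1[of b "a - length p"] *
      by (auto simp: order_iso_def nth_append len)
  qed (simp add: len)
qed

lemma order_iso_map_add [simp]:
  "order_iso (map (\<lambda>x. x + n) s) p \<longleftrightarrow> order_iso s p"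
  "order_iso s (map (\<lambda>x. x + n) p) \<longleftrightarrow> order_iso s p"
  by (auto simp: order_iso_def)

lemma subseq_set_subset: "subseq v w \<Longrightarrow> set v \<subseteq> set w"
  by (auto elim: list_emb_set)

lemma contains_subseq: "contains v p \<Longrightarrow> subseq v w \<Longrightarrow> contains w p"
  unfolding contains_def by (blast intro: subseq_order.trans)

lemma contains_map_add [simp]: "contains (map (\<lambda>x. x + n) w) p \<longleftrightarrow> contains w p"
proof
  assume "contains (map (\<lambda>x. x + n) w) p"
  then obtain s where s: "subseq s (map (\<lambda>x. x + n) w)" "order_iso s p"
    by (auto simp: contains_def)
  then obtain N where "s = nths (map (\<lambda>x. x + n) w) N" by (auto simp: subseq_conv_nths)
  then have "s = map (\<lambda>x. x + n) (nths w N)" by (simp add: nths_map)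
  then show "contains w p" using s(2) by (auto simp: contains_def subseq_conv_nths)
next
  assume "contains w p"
  then show "contains (map (\<lambda>x. x + n) w) p"
    unfolding contains_def by (metis subseq_map order_iso_map_add(1))
qed

lemma contains_Nil_left: "contains [] p \<longleftrightarrow> p = []"
  by (cases p) (auto simp: contains_def order_iso_def)

lemma contains_pcomp:
  assumes pos: "\<forall>x\<in>set w. 0 < x" "\<forall>x\<in>set q. 0 < x"
  shows "contains w (pcomp p q) \<longleftrightarrow>
    (\<exists>w1 w2 k. w = w1 @ w2 \<and> contains (filter (\<lambda>x. x \<le> k) w1) p \<and> contains (filter (\<lambda>x. k < x) w2) q)"
    (is "?L \<longleftrightarrow> ?R")
proof
  have less: "\<forall>a\<in>set p. \<forall>b\<in>set (map (\<lambda>x. x + nblocks p) q). a < b"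
    using pos(2) by (fastforce dest: le_nblocks)
  {
    assume ?L
    then obtain s where s: "subseq s w" "order_iso s (pcomp p q)" by (auto simp: contains_def)
    define s1 s2 where "s1 = take (length p) s" and "s2 = drop (length p) s"
    have s12: "s = s1 @ s2" "length s1 = length p"
      using s(2) by (auto simp: s1_def s2_def order_iso_def pcomp_def)
    note iso = order_iso_appendD[OF s(2)[unfolded s12(1) pcomp_def] s12(2)]
    obtain w1 w2 where w: "w = w1 @ w2" "subseq s1 w1" "subseq s2 w2"
      using s(1) unfolding s12(1) by (auto dest: list_emb_appendD)
    have "nblocks s1 < y" if "y \<in> set s2" for y
    proof (cases "s1 = []")
      case True
      then show ?thesis using that pos(1) w by (auto dest: list_emb_set)
    next
      case False
      then show ?thesis using iso(3)[OF nblocks_in_set that] less by blast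
    qed
    then have "filter (\<lambda>x. x \<le> nblocks s1) s1 = s1" "filter (\<lambda>x. nblocks s1 < x) s2 = s2"
      by (auto simp: filter_id_conv le_nblocks)
    then have "subseq s1 (filter (\<lambda>x. x \<le> nblocks s1) w1)" "subseq s2 (filter (\<lambda>x. nblocks s1 < x) w2)"
      using w(2,3) by (metis subseq_filter)+
    then show ?R using w(1) iso(1,2) unfolding contains_def order_iso_map_add by blast
  }
  {
    assume ?R
    then obtain w1 w2 k s1 s2 where w: "w = w1 @ w2"
      and s1: "subseq s1 (filter (\<lambda>x. x \<le> k) w1)" "order_iso s1 p"
      and s2: "subseq s2 (filter (\<lambda>x. k < x) w2)" "order_iso s2 q"
      unfolding contains_def by blast
    have "\<forall>a\<in>set s1. \<forall>b\<in>set s2. a < b"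
    proof (intro ballI)
      fix a b assume "a \<in> set s1" "b \<in> set s2"
      then have "a \<in> set (filter (\<lambda>x. x \<le> k) w1)" "b \<in> set (filter (\<lambda>x. k < x) w2)"
        using s1(1) s2(1) by (blast dest: list_emb_set)+
      then show "a < b" by simp
    qed
    then have "order_iso (s1 @ s2) (pcomp p q)"
      unfolding pcomp_def using s1 s2 less by (intro order_iso_appendI) auto
    moreover have "subseq (s1 @ s2) w"
      unfolding w using s1(1) s2(1) by (meson list_emb_append_mono subseq_filter_left subseq_order.trans)
    ultimately show ?L by (auto simp: contains_def)
  }
qed

lemma contains_filter_ge_hd:
  assumes "contains w p" "is_partition p" "p \<noteq> []"
  shows "\<exists>m\<in>set w. contains (filter (\<lambda>x. m \<le> x) w) p"
proof -
  obtain s where s: "subseq s w" "order_iso s p" using assms by (auto simp: contains_def)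
  have len: "0 < length p" "length s = length p" using assms s by (auto simp: order_iso_def)
  have "p ! 0 = 1" using assms(2,3) is_partition_hd by (cases p) auto
  then have "p ! 0 \<le> p ! i" if "i < length p" for i
    using is_partition_pos[OF assms(2) nth_mem[OF that]] by simp
  then have "\<forall>y\<in>set s. s ! 0 \<le> y"
    using s(2) len unfolding order_iso_def by (metis in_set_conv_nth)
  then have "filter (\<lambda>x. s ! 0 \<le> x) s = s" by (simp add: filter_id_conv)
  then have "subseq s (filter (\<lambda>x. s ! 0 \<le> x) w)" using s(1) by (metis subseq_filter)
  moreover have "s ! 0 \<in> set w"
    using len by (intro subsetD[OF subseq_set_subset[OF s(1)]]) simp
  ultimately show ?thesis using s(2) by (auto simp: contains_def)
qed

lemma contains_1212: "contains w [1,2,1,2] \<longleftrightarrow> (\<exists>a b. a < b \<and> subseq [a,b,a,b] w)"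
proof
  assume "contains w [1,2,1,2]"
  then obtain s where s: "subseq s w" "order_iso s [1,2,1,2]" by (auto simp: contains_def)
  then have "length s = 4" by (simp add: order_iso_def)
  then obtain a b c d where abcd: "s = [a,b,c,d]"
    by (auto simp: length_Suc_conv eval_nat_numeral)
  have iso: "(s ! i \<le> s ! j) = ([1,2,1,2::nat] ! i \<le> [1,2,1,2] ! j)" if "i < 4" "j < 4" for i j
    using s(2) that by (simp add: order_iso_def)
  have "a < b" "a = c" "b = d"
    using iso[of 1 0] iso[of 0 2] iso[of 2 0] iso[of 1 3] iso[of 3 1] 
    by (simp_all add: abcd eval_nat_numeral)
  then show "\<exists>a b. a < b \<and> subseq [a,b,a,b] w" using s(1) abcd by blast
next
  assume "\<exists>a b. a < b \<and> subseq [a,b,a,b] w"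
  then obtain a b where ab: "a < b" "subseq [a,b,a,b] w" by blast
  have "order_iso [a,b,a,b] [1,2,1,2]"
    using ab(1) by (auto simp: order_iso_def less_Suc_eq nth_Cons')
  then show "contains w [1,2,1,2]" using ab by (auto simp: contains_def)
qed

section \<open>The stack of open blocks\<close>

text \<open>The stack is listed from top (largest letter) to bottom. Since a new maximum drops nothing, the
  same equation covers opening a block and returning to one.\<close>

fun open_blocks :: "nat list \<Rightarrow> nat list \<Rightarrow> nat list" where
  "open_blocks st [] = st"
| "open_blocks st (x # w) = open_blocks (x # dropWhile (\<lambda>y. x \<le> y) st) w"

fun nc_extends :: "nat list \<Rightarrow> nat \<Rightarrow> nat list \<Rightarrow> bool" where
  "nc_extends st n [] = True"
| "nc_extends st n (x # w) \<longleftrightarrow>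
     (x = Suc n \<or> x \<in> set st) \<and> nc_extends (x # dropWhile (\<lambda>y. x \<le> y) st) (max n x) w"

lemma open_blocks_append: "open_blocks st (v @ w) = open_blocks (open_blocks st v) w"
  by (induction v arbitrary: st) auto

lemma nc_extends_append:
  "nc_extends st n (v @ w) \<longleftrightarrow> nc_extends st n v \<and> nc_extends (open_blocks st v) (max n (nblocks v)) w"
  by (induction v arbitrary: st n) (auto simp: max.assoc)

lemma set_dropWhile_ge:
  "sorted_wrt (>) st \<Longrightarrow> set (dropWhile (\<lambda>y. x \<le> y) st) = {y \<in> set st. y < (x::nat)}"
  by (induction st) auto

lemma sorted_open_blocks: "sorted_wrt (>) st \<Longrightarrow> sorted_wrt (>) (open_blocks st w)"
proof (induction w arbitrary: st)
  case (Cons x w)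
  have "sorted_wrt (>) (dropWhile (\<lambda>y. x \<le> y) st)"
    using Cons.prems by (induction st) auto
  then have "sorted_wrt (>) (x # dropWhile (\<lambda>y. x \<le> y) st)"
    using set_dropWhile_ge[OF Cons.prems, of x] by simp
  then show ?case using Cons.IH by simp
qed simp

lemma set_open_blocks:
  "set (open_blocks [] w) = {y. \<exists>u v. w = u @ y # v \<and> (\<forall>z\<in>set v. y \<le> z)}"
proof (induction w rule: rev_induct)
  case (snoc x w)
  have "set (open_blocks [] (w @ [x])) = insert x {y \<in> set (open_blocks [] w). y < x}"
    using set_dropWhile_ge[OF sorted_open_blocks, of "[]" x w] by (simp add: open_blocks_append)
  also have "\<dots> = {y. \<exists>u v. w @ [x] = u @ y # v \<and> (\<forall>z\<in>set v. y \<le> z)}" (is "?A = ?B")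
  proof
    show "?A \<subseteq> ?B"
      unfolding snoc by (fastforce intro: exI[of _ "[]"])
    show "?B \<subseteq> ?A"
    proof
      fix y assume "y \<in> ?B"
      then obtain u v where uv: "w @ [x] = u @ y # v" "\<forall>z\<in>set v. y \<le> z" by blast
      show "y \<in> ?A"
      proof (cases v rule: rev_cases)
        case (snoc v' z)
        then have "w = u @ y # v'" "z = x" using uv by auto
        then show ?thesis unfolding \<open>set (open_blocks [] w) = _\<close> using uv snoc by fastforce
      qed (use uv in auto)
    qed
  qed
  finally show ?case .
qed simp

lemma subseq_snoc_iff: "subseq (s @ [b]) (w @ [x]) \<longleftrightarrow> subseq (s @ [b]) w \<or> b = x \<and> subseq s w"
proof
  assume "subseq (s @ [b]) (w @ [x])"
  then obtain t1 t2 where t: "s @ [b] = t1 @ t2" "subseq t1 w" "subseq t2 [x]"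
    unfolding subseq_append_iff by blast
  then show "subseq (s @ [b]) w \<or> b = x \<and> subseq s w"
    using list_emb_length[OF t(3)] by (cases t2 rule: rev_cases) (auto split: if_splits)
qed (auto intro: list_emb_append_mono)

lemma noncrossing_iff_subseq:
  "noncrossing w \<longleftrightarrow> is_partition w \<and> (\<forall>a b. a < b \<longrightarrow> \<not> subseq [a,b,a,b] w)"
  unfolding noncrossing_def contains_1212 by blast

lemma noncrossing_Nil [simp]: "noncrossing []"
  by (simp add: noncrossing_def contains_Nil_left)

lemma noncrossing_no_return:
  assumes "noncrossing (a @ y # b @ x # c)" "x < y"
  shows "y \<notin> set c"
proof
  assume "y \<in> set c"
  have "0 < x" using assms is_partition_pos[of _ x] by (auto simp: noncrossing_def)
  then have "x \<in> set a"
    using assms is_partition_smaller_before[of a y _ x] by (auto simp: noncrossing_def)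
  then have "subseq ([x] @ [y] @ [x] @ [y]) (a @ [y] @ (b @ [x]) @ c)"
    using \<open>y \<in> set c\<close>
    by (intro list_emb_append_mono) (auto simp: subseq_singleton_left)
  then show False
    using assms by (auto simp: noncrossing_iff_subseq)
qed

lemma noncrossing_snoc:
  "noncrossing (w @ [x]) \<longleftrightarrow>
     noncrossing w \<and> (x = Suc (nblocks w) \<or> x \<in> set (open_blocks [] w))" (is "?L \<longleftrightarrow> ?R")
proof
  assume ?L
  then have part: "is_partition w" "1 \<le> x" "x \<le> Suc (nblocks w)"
    by (auto simp: noncrossing_def is_partition_snoc)
  have w: "noncrossing w"
    using \<open>?L\<close> part contains_subseq[of w _ "w @ [x]"] by (auto simp: noncrossing_def)
  have "x \<in> set (open_blocks [] w)" if "x \<noteq> Suc (nblocks w)"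
  proof -
    have "x \<in> set w" using is_partition_surj[of w x] part that by simp
    then obtain u v where uv: "w = u @ x # v" by (auto simp: in_set_conv_decomp)
    have "x \<le> z" if z: "z \<in> set v" for z
    proof (rule ccontr)
      assume "\<not> x \<le> z"
      moreover obtain v1 v2 where "v = v1 @ z # v2" using z by (auto simp: in_set_conv_decomp)
      ultimately show False
        using \<open>?L\<close> noncrossing_no_return[of u x v1 z "v2 @ [x]"] uv by simp
    qed
    then show ?thesis unfolding set_open_blocks using uv by blast
  qed
  with w show ?R by blast
next
  assume ?R
  then have w: "is_partition w" "\<forall>a b. a < b \<longrightarrow> \<not> subseq [a,b,a,b] w"
    by (auto simp: noncrossing_iff_subseq)
  show ?L
  proof (cases "x = Suc (nblocks w)")
    case True
    then have "x \<notin> set w" by (auto dest: le_nblocks)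
    have "\<not> subseq ([a,x,a] @ [x]) (w @ [x])" for a
      using \<open>x \<notin> set w\<close> by (auto simp only: subseq_snoc_iff dest!: subseq_set_subset) auto
    then show ?thesis
      using w True subseq_snoc_iff[of "[_,_,_]" _ w x]
      by (auto simp: noncrossing_iff_subseq is_partition_snoc)
  next
    case False
    then obtain u v where uv: "w = u @ x # v" "\<forall>z\<in>set v. x \<le> z"
      using \<open>?R\<close> by (auto simp: set_open_blocks)
    have "\<not> subseq [a,x,a] w" if "a < x" for a
    proof
      assume "subseq [a,x,a] w"
      then obtain t1 t2 where t: "[a,x,a] = t1 @ t2" "subseq t1 u" "subseq t2 (x # v)"
        unfolding uv subseq_append_iff by blast
      have "a \<notin> set t2" using subseq_set_subset[OF t(3)] uv(2) that by fastforce
      then have "t2 = []" using t(1) by (cases t2 rule: rev_cases) auto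
      then have "subseq ([a,x,a] @ [x]) (u @ x # v)" using t by (intro list_emb_append_mono) auto
      then show False using w that uv by auto
    qed
    moreover have "is_partition (w @ [x])"
      unfolding is_partition_snoc
      using w(1) uv(1) is_partition_pos[of w x] le_nblocks[of x w] by auto
    ultimately show ?thesis
      using w(2) subseq_snoc_iff[of "[_,_,_]" _ w x] by (auto simp: noncrossing_iff_subseq)
  qed
qed

lemma noncrossing_iff_nc_extends: "noncrossing w \<longleftrightarrow> nc_extends [] 0 w"
  by (induction w rule: rev_induct) (auto simp: noncrossing_snoc nc_extends_append)

lemma noncrossing_append:
  "noncrossing (v @ w) \<longleftrightarrow> noncrossing v \<and> nc_extends (open_blocks [] v) (nblocks v) w"
  by (simp add: noncrossing_iff_nc_extends nc_extends_append)

lemma open_blocks_subset: "set (open_blocks st w) \<subseteq> set st \<union> set w"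
proof (induction w arbitrary: st)
  case (Cons x w)
  then show ?case using set_dropWhileD[of _ "\<lambda>y. x \<le> y" st] by fastforce
qed simp

lemma noncrossing_pos: "noncrossing w \<Longrightarrow> x \<in> set w \<Longrightarrow> 0 < x"
  by (auto simp: noncrossing_def dest: is_partition_pos)

lemma dropWhile_shift:
  fixes n x :: nat
  assumes "\<forall>y\<in>set st. y \<le> n" "0 < x"
  shows "dropWhile (\<lambda>y. x + n \<le> y) (map (\<lambda>x. x + n) s @ st) = map (\<lambda>x. x + n) (dropWhile (\<lambda>y. x \<le> y) s) @ st"
proof (induction s)
  case Nil
  have "\<not> x + n \<le> y" if "y \<in> set st" for y using assms(2) bspec[OF assms(1) that] by linarith
  then show ?case by (cases st) auto
qed auto

lemma open_blocks_shift:
  assumes "\<forall>y\<in>set st. y \<le> n" "\<forall>x\<in>set w. 0 < x"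
  shows "open_blocks (map (\<lambda>x. x + n) s @ st) (map (\<lambda>x. x + n) w) = map (\<lambda>x. x + n) (open_blocks s w) @ st"
  using assms(2)
proof (induction w arbitrary: s)
  case (Cons x w)
  then show ?case using Cons.IH[of "x # dropWhile (\<lambda>y. x \<le> y) s"] by (simp add: dropWhile_shift[OF assms(1)])
qed simp

lemma nc_extends_shift:
  assumes "\<forall>y\<in>set st. y \<le> n" "\<forall>x\<in>set w. 0 < x"
  shows "nc_extends s m w \<Longrightarrow> nc_extends (map (\<lambda>x. x + n) s @ st) (m + n) (map (\<lambda>x. x + n) w)"
  using assms(2)
proof (induction w arbitrary: s m)
  case (Cons x w)
  then show ?case using Cons.IH[of "x # dropWhile (\<lambda>y. x \<le> y) s" "max m x"]
    by (auto simp: dropWhile_shift[OF assms(1)] nat_add_max_left)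
qed simp

lemma noncrossing_shift:
  assumes "\<forall>y\<in>set st. y \<le> n" "noncrossing w"
  shows "nc_extends st n (map (\<lambda>x. x + n) w)"
    "open_blocks st (map (\<lambda>x. x + n) w) = map (\<lambda>x. x + n) (open_blocks [] w) @ st"
  using nc_extends_shift[OF assms(1), of w "[]" 0] open_blocks_shift[OF assms(1), of w "[]"]
    assms(2) noncrossing_pos[OF assms(2)] by (simp_all add: noncrossing_iff_nc_extends)

lemma open_blocks_le_nblocks: "\<forall>y\<in>set (open_blocks [] w). y \<le> nblocks w"
  using open_blocks_subset[of "[]" w] le_nblocks by auto

lemma nblocks_pcomp [simp]: "nblocks (pcomp v w) = nblocks v + nblocks w"
  by (cases "w = []") (auto simp: pcomp_def nblocks_map_add)

lemma pcomp_assoc: "pcomp (pcomp u v) w = pcomp u (pcomp v w)"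
  by (simp add: pcomp_def nblocks_pcomp[unfolded pcomp_def] add.assoc add.commute
    del: nblocks_append)

lemma pcomp_Nil [simp]: "pcomp [] w = w" "pcomp w [] = w"
  by (simp_all add: pcomp_def)

lemma noncrossing_pcomp:
  assumes "noncrossing v" "noncrossing w"
  shows "noncrossing (pcomp v w)"
    "open_blocks [] (pcomp v w) = map (\<lambda>x. x + nblocks v) (open_blocks [] w) @ open_blocks [] v"
  unfolding pcomp_def noncrossing_append open_blocks_append
  using assms noncrossing_shift[OF open_blocks_le_nblocks] by auto

lemma noncrossing_pcompD:
  assumes "noncrossing (pcomp v w)" "\<forall>x\<in>set w. 0 < x"
  shows "noncrossing v" "noncrossing w"
proof -
  show v: "noncrossing v" using assms(1) by (simp add: pcomp_def noncrossing_append)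
  have "subseq (map (\<lambda>x. x + nblocks v) w) (pcomp v w)" by (auto simp: pcomp_def)
  then have "\<not> contains w [1,2,1,2]"
    using assms(1) by (auto simp: noncrossing_def dest: contains_subseq[rotated])
  moreover have "is_partition w"
    using assms v by (auto simp: noncrossing_def pcomp_def is_partition_append_shift)
  ultimately show "noncrossing w" by (simp add: noncrossing_def)
qed

section \<open>Components and fillings\<close>

lemma map_diff_add: "\<forall>x\<in>set w. n < x \<Longrightarrow> map (\<lambda>x. x + n) (map (\<lambda>x. x - n) w) = (w :: nat list)"
  by (induction w) auto

lemma split_first_block:
  assumes "noncrossing (P @ Suc (nblocks P) # S)"
  obtains C S' where "Suc (nblocks P) # S = map (\<lambda>x. x + nblocks P) C @ S'"
    "noncrossing C" "C \<noteq> []" "last C = 1" "\<forall>x\<in>set S'. x \<le> nblocks P \<or> nblocks P + nblocks C < x"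
proof -
  let ?N = "nblocks P"
  obtain C0 S' where S: "Suc ?N # S = C0 @ Suc ?N # S'" "Suc ?N \<notin> set S'"
    using split_list_last[of "Suc ?N" "Suc ?N # S"] by auto
  define C' where "C' = C0 @ [Suc ?N]"
  define C where "C = map (\<lambda>x. x - ?N) C'"
  have nc: "noncrossing (P @ C0 @ Suc ?N # S')" using assms S by simp
  have big: "?N < x" if "x \<in> set C'" for x
  proof (rule ccontr)
    assume less: "\<not> ?N < x"
    then have "x \<in> set C0" using that by (auto simp: C'_def)
    then obtain c1 c2 where c: "C0 = c1 @ x # c2" by (auto simp: in_set_conv_decomp)
    then have "c1 \<noteq> []" "hd c1 = Suc ?N" using S(1) less by (cases c1; auto)+
    then obtain c3 where "c1 = Suc ?N # c3" by (cases c1) auto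
    then show False
      using noncrossing_no_return[of P "Suc ?N" c3 x "c2 @ Suc ?N # S'"] nc less c by simp
  qed
  have C': "C' = map (\<lambda>x. x + ?N) C"
    unfolding C_def using map_diff_add big by metis
  have "noncrossing ((P @ C') @ S')" using nc by (simp add: C'_def)
  then have ncC': "noncrossing (P @ C')" using noncrossing_append by blast
  show thesis
  proof (rule that)
    show "Suc ?N # S = map (\<lambda>x. x + ?N) C @ S'" using S C' by (simp add: C'_def)
    show "noncrossing C"
      using noncrossing_pcompD(2)[of P C] ncC' big unfolding pcomp_def C'[symmetric] by (auto simp: C_def)
    show "C \<noteq> []" by (simp add: C_def C'_def)
    show "last C = 1" by (simp add: C_def C'_def)
    show "\<forall>x\<in>set S'. x \<le> ?N \<or> ?N + nblocks C < x"
    proof (rule ccontr)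
      assume "\<not> ?thesis"
      then obtain x where x: "x \<in> set S'" "?N < x" "x \<le> ?N + nblocks C" by auto
      have "nblocks (P @ C') = ?N + nblocks C"
        using nblocks_pcomp[of P C] by (simp only: pcomp_def C')
      then have "x \<in> set (P @ C')"
        using is_partition_surj[of "P @ C'" x] ncC' x by (auto simp: noncrossing_def)
      then have "x \<in> set C0" using x S(2) le_nblocks[of x P] by (auto simp: C'_def)
      then obtain c1 c2 where c: "C0 = c1 @ x # c2" by (auto simp: in_set_conv_decomp)
      have "x \<noteq> Suc ?N" using x(1) S(2) by blast
      then show False
        using noncrossing_no_return[of "P @ c1" x c2 "Suc ?N" S'] nc c x by simp
    qed
  qed
qed

lemma connected_iff_last:
  assumes "noncrossing c"
  shows "connected_part c \<longleftrightarrow> c \<noteq> [] \<and> last c = 1"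
proof
  assume conn: "connected_part c"
  then obtain S where c: "c = Suc (nblocks []) # S"
    using assms is_partition_hd by (cases c) (auto simp: connected_part_def noncrossing_def)
  then obtain C S' where C: "c = C @ S'" "noncrossing C" "C \<noteq> []" "last C = 1"
    "\<forall>x\<in>set S'. x = 0 \<or> nblocks C < x"
    using split_first_block[of "[]" S] assms by auto
  then have big: "\<forall>x\<in>set S'. nblocks C < x" using noncrossing_pos[OF assms] by fastforce
  define T where "T = map (\<lambda>x. x - nblocks C) S'"
  have "S' = map (\<lambda>x. x + nblocks C) T"
    unfolding T_def using map_diff_add big by metis
  then have "c = pcomp C T" using C by (simp add: pcomp_def)
  moreover have "noncrossing T"
    using noncrossing_pcompD(2)[of C T] assms calculation big by (auto simp: T_def)
  ultimately have "T = []" using conn C by (auto simp: connected_part_def noncrossing_def)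
  then show "c \<noteq> [] \<and> last c = 1" using C by (simp add: T_def)
next
  assume c: "c \<noteq> [] \<and> last c = 1"
  have False if "is_partition \<alpha>" "is_partition \<beta>" "\<alpha> \<noteq> []" "\<beta> \<noteq> []" "c = pcomp \<alpha> \<beta>" for \<alpha> \<beta>
  proof -
    have "last c = last \<beta> + nblocks \<alpha>" using that by (simp add: pcomp_def last_map)
    moreover have "0 < last \<beta>" using that is_partition_pos by auto
    moreover have "0 < nblocks \<alpha>"
      using that(1,3) is_partition_pos nblocks_in_set by blast
    ultimately show False using c by simp
  qed
  then show "connected_part c" using c by (auto simp: connected_part_def)
qed

lemma open_blocks_connected:
  assumes "noncrossing c" "connected_part c"
  shows "open_blocks [] c = [1]"
proof -
  obtain c' where c': "c = c' @ [1]"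
    using assms connected_iff_last by (metis append_butlast_last_id)
  have "1 \<le> y" if "y \<in> set (open_blocks [] c')" for y
    using that open_blocks_subset[of "[]" c'] noncrossing_pos[OF assms(1)] c' by fastforce
  then have "dropWhile (\<lambda>y. 1 \<le> y) (open_blocks [] c') = []" by simp
  then show ?thesis by (simp add: c' open_blocks_append)
qed

definition components :: "nat list list \<Rightarrow> bool" where
  "components cs \<longleftrightarrow> (\<forall>c\<in>set cs. noncrossing c \<and> connected_part c)"

lemma foldl_pcomp: "foldl pcomp v cs = pcomp v (foldl pcomp [] cs)"
proof (induction cs arbitrary: v)
  case (Cons c cs)
  show ?case using Cons[of "pcomp v c"] Cons[of c] by (simp add: pcomp_assoc)
qed simp

lemma components_join:
  assumes "components cs"
  shows "noncrossing (foldl pcomp [] cs)" "length (open_blocks [] (foldl pcomp [] cs)) = length cs"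
  using assms
  by (induction cs rule: rev_induct)
    (simp_all add: components_def noncrossing_pcomp open_blocks_connected)

lemma components_of_noncrossing:
  assumes "\<forall>c\<in>set cs. is_partition c \<and> connected_part c" "noncrossing (foldl pcomp [] cs)"
  shows "components cs"
  using assms
proof (induction cs rule: rev_induct)
  case (snoc c cs)
  then have "\<forall>x\<in>set c. 0 < x" by (auto dest: is_partition_pos)
  then have "noncrossing (foldl pcomp [] cs)" "noncrossing c"
    using noncrossing_pcompD[of "foldl pcomp [] cs" c] snoc.prems by auto
  then show ?case using snoc by (auto simp: components_def)
qed (simp add: components_def)

lemma pcomp_connected_inject_aux:
  assumes "pcomp v c = pcomp v' c'" "noncrossing c" "connected_part c"
    "noncrossing c'" "connected_part c'" "length v \<le> length v'"
  shows "v = v'"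
proof (rule ccontr)
  assume neq: "v \<noteq> v'"
  obtain r where r: "v' = v @ r" "map (\<lambda>x. x + nblocks v) c = r @ map (\<lambda>x. x + nblocks v') c'"
    using assms(1,6) by (auto simp: pcomp_def append_eq_append_conv2)
  have c: "c \<noteq> []" "last c = 1" "c' \<noteq> []" "last c' = 1"
    using assms connected_iff_last by auto
  have "hd c = 1" using assms(2) c(1) is_partition_hd by (cases c) (auto simp: noncrossing_def)
  then have "hd r = Suc (nblocks v)" "r \<noteq> []"
    using r neq c(1) by (auto simp: hd_append hd_map dest!: arg_cong[of "map _ _" _ hd])
  then have "Suc (nblocks v) \<le> nblocks v'" using r(1) le_nblocks[of "hd r" r] hd_in_set[of r] by simp
  moreover have "Suc (nblocks v) = Suc (nblocks v')"
    using arg_cong[OF r(2), of last] c by (simp add: last_map)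
  ultimately show False by simp
qed

lemma pcomp_connected_inject:
  assumes "pcomp v c = pcomp v' c'" "noncrossing c" "connected_part c"
    "noncrossing c'" "connected_part c'"
  shows "v = v' \<and> c = c'"
proof -
  have "v = v'"
    using pcomp_connected_inject_aux[OF assms]
      pcomp_connected_inject_aux[OF assms(1)[symmetric] assms(4,5,2,3)] by (cases "length v \<le> length v'") auto
  then show ?thesis using assms(1) by (auto simp: pcomp_def inj_def dest!: map_injective)
qed

lemma components_unique:
  assumes "components cs" "components cs'" "foldl pcomp [] cs = foldl pcomp [] cs'"
  shows "cs = cs'"
  using assms
proof (induction cs arbitrary: cs' rule: rev_induct)
  case Nil
  then show ?case using components_join(2)[of "[]"] components_join(2)[of cs'] by simp
next
  case (snoc c cs)
  then have "length cs' = length (cs @ [c])"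
    using components_join(2)[of "cs @ [c]"] components_join(2)[of cs'] by simp
  then obtain ds d where ds: "cs' = ds @ [d]" by (cases cs' rule: rev_cases) auto
  have c: "components cs" "noncrossing c" "connected_part c"
    and d: "components ds" "noncrossing d" "connected_part d"
    using snoc.prems(1,2) by (simp_all add: ds components_def)
  have "pcomp (foldl pcomp [] cs) c = pcomp (foldl pcomp [] ds) d"
    using snoc.prems(3) by (simp add: ds)
  then have "foldl pcomp [] cs = foldl pcomp [] ds \<and> c = d"
    using pcomp_connected_inject c(2,3) d(2,3) by blast
  then show ?case using snoc.IH[OF c(1) d(1)] ds by simp
qed

text \<open>\<open>None\<close> is a hole for the next component and \<open>Some y\<close> an old letter; \<open>N\<close> is the number of blocks
  used so far. The last equation also covers the mismatched case of a hole without a component.\<close>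

fun fill :: "nat \<Rightarrow> nat option list \<Rightarrow> nat list list \<Rightarrow> nat list" where
  "fill N (None # u) (c # cs) = map (\<lambda>x. x + N) c @ fill (N + nblocks c) u cs"
| "fill N (Some y # u) cs = y # fill N u cs"
| "fill N _ _ = []"

fun letters :: "nat option list \<Rightarrow> nat list" where
  "letters [] = []"
| "letters (None # u) = letters u"
| "letters (Some y # u) = y # letters u"

abbreviation holes :: "nat option list \<Rightarrow> nat" where
  "holes u \<equiv> count_list u None"

lemma fill_exists:
  assumes "noncrossing (P @ S)" "M \<le> nblocks P" "\<forall>x\<in>set S. x \<le> M \<or> nblocks P < x"
  shows "\<exists>u cs. S = fill (nblocks P) u cs \<and> holes u = length cs \<and> components cs
    \<and> letters u = filter (\<lambda>x. x \<le> M) S"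
  using assms
proof (induction "length S" arbitrary: P S rule: less_induct)
  case less
  show ?case
  proof (cases S)
    case Nil
    then show ?thesis by (intro exI[of _ "[]"]) (simp add: components_def)
  next
    case (Cons x S0)
    show ?thesis
    proof (cases "x \<le> M")
      case True
      then have "nblocks (P @ [x]) = nblocks P" using less.prems by simp
      then obtain u cs where "S0 = fill (nblocks P) u cs" "holes u = length cs" "components cs"
        "letters u = filter (\<lambda>x. x \<le> M) S0"
        using less.hyps[of S0 "P @ [x]"] less.prems Cons by auto
      then show ?thesis using Cons True
        by (intro exI[of _ "Some x # u"] exI[of _ cs]) simp
    next
      case False
      then have "nblocks P < x" using less.prems Cons by auto
      moreover have "is_partition (P @ [x])"
        using less.prems(1) Cons is_partition_appendD[of "P @ [x]" S0] by (simp add: noncrossing_def)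
      ultimately have x: "x = Suc (nblocks P)" by (simp add: is_partition_snoc)
      obtain C S' where C: "S = map (\<lambda>x. x + nblocks P) C @ S'" "noncrossing C" "C \<noteq> []" "last C = 1"
        "\<forall>x\<in>set S'. x \<le> nblocks P \<or> nblocks P + nblocks C < x"
        using split_first_block[of P S0] less.prems(1) Cons x by metis
      have nb: "nblocks (P @ map (\<lambda>x. x + nblocks P) C) = nblocks P + nblocks C"
        using nblocks_pcomp by (simp only: pcomp_def)
      have "\<forall>x\<in>set S'. x \<le> M \<or> nblocks P + nblocks C < x"
        using C(1,5) less.prems(3) by (auto simp: not_le dest: leD)
      then obtain u cs where u: "S' = fill (nblocks P + nblocks C) u cs" "holes u = length cs"
        "components cs" "letters u = filter (\<lambda>x. x \<le> M) S'"
        using less.hyps[of S' "P @ map (\<lambda>x. x + nblocks P) C", unfolded nb] less.prems C(1,3) by auto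
      have "\<not> x + nblocks P \<le> M" if "x \<in> set C" for x
        using noncrossing_pos[OF C(2) that] less.prems(2) by simp
      then have "filter (\<lambda>x. x \<le> M) (map (\<lambda>x. x + nblocks P) C) = []"
        by (auto simp: filter_empty_conv)
      then show ?thesis using u C connected_iff_last[OF C(2)]
        by (intro exI[of _ "None # u"] exI[of _ "C # cs"]) (auto simp: components_def)
    qed
  qed
qed

lemma filter_fill:
  assumes "components cs" "holes u = length cs" "\<forall>x\<in>set (letters u). x \<le> M" "M \<le> N"
  shows "filter (\<lambda>x. M < x) (fill N u cs) = map (\<lambda>x. x + N) (foldl pcomp [] cs)"
  using assms
proof (induction N u cs rule: fill.induct)
  case (1 N u c cs)
  have "filter (\<lambda>x. M < x) (map (\<lambda>x. x + N) c) = map (\<lambda>x. x + N) c"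
    using 1(2,5) noncrossing_pos[of c] by (fastforce simp: filter_id_conv components_def)
  then show ?case using 1 foldl_pcomp[of c cs]
    by (simp add: components_def pcomp_def[of c] comp_def add.assoc add.commute[of "nblocks c"])
qed auto

lemma length_fill:
  assumes "holes u = length cs"
  shows "length (fill N u cs) = length (letters u) + length (foldl pcomp [] cs)"
  using assms
proof (induction N u cs rule: fill.induct)
  case (1 N u c cs)
  then show ?case using foldl_pcomp[of c cs] by (simp add: pcomp_def[of c])
qed auto

lemma fill_eq_Nil: "fill N u cs = [] \<Longrightarrow> components cs \<Longrightarrow> holes u = length cs \<Longrightarrow> u = []"
  by (cases u rule: letters.cases; cases cs) (auto simp: components_def connected_part_def)

lemma fill_inject:
  assumes "components cs" "holes u = length cs" "holes u' = length cs" 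
    "\<forall>x\<in>set (letters u). x \<le> M" "\<forall>x\<in>set (letters u'). x \<le> M" "M \<le> N"
    "fill N u cs = fill N u' cs"
  shows "u = u'"
  using assms
proof (induction N u cs arbitrary: u' rule: fill.induct)
  case (1 N u c cs)
  have c: "c \<noteq> []" "\<forall>x\<in>set c. 0 < x" using 1(2) noncrossing_pos by (auto simp: components_def connected_part_def)
  then have "0 < hd c" using hd_in_set by blast
  then have "M < hd (map (\<lambda>x. x + N) c)" using 1(7) \<open>0 < hd c\<close> c(1) by (simp add: hd_map)
  then have hd: "M < hd (fill N (None # u) (c # cs))" using c by simp
  obtain z v where u': "u' = z # v" using 1(4) by (cases u') auto
  then have z: "z = None" using 1(6,8) hd by (cases z) auto
  show ?case using 1 u' z by (simp add: components_def)
next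
  case (2 N y u cs)
  obtain z v where u': "u' = z # v" using 2(8) by (cases u'; cases cs) auto
  show ?case
  proof (cases z)
    case None
    then obtain c ds where cs: "cs = c # ds" using 2(4) u' by (cases cs) auto
    have c: "c \<noteq> []" "\<forall>x\<in>set c. 0 < x"
      using 2(2) cs noncrossing_pos by (auto simp: components_def connected_part_def)
    then have "0 < hd c" using hd_in_set by blast
  then have "M < hd (map (\<lambda>x. x + N) c)" using 2(7) \<open>0 < hd c\<close> c(1) by (simp add: hd_map)
    then have "M < hd (fill N u' cs)" using c u' None cs by simp
    then show ?thesis using 2(5,8) by (auto simp flip: 2(8))
  next
    case (Some y')
    then show ?thesis using 2 u' by simp
  qed
qed (auto dest: fill_eq_Nil[OF sym])

fun trailing_holes :: "nat \<Rightarrow> nat option list \<Rightarrow> nat" where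
  "trailing_holes b [] = b"
| "trailing_holes b (None # u) = trailing_holes (Suc b) u"
| "trailing_holes b (Some y # u) = trailing_holes 0 u"

lemma nc_extends_fill:
  assumes "components cs" "holes u = length cs" "\<forall>x\<in>set (letters u). x \<le> M" "M \<le> N"
    "\<forall>x\<in>set B. M < x \<and> x \<le> N" "\<forall>x\<in>set st. x \<le> M" "nc_extends st M (letters u)"
  shows "nc_extends (B @ st) N (fill N u cs)"
    "length (open_blocks (B @ st) (fill N u cs)) =
       trailing_holes (length B) u + length (open_blocks st (letters u))"
  using assms
proof (induction N u cs arbitrary: B st rule: fill.induct)
  case (1 N u c cs)
  {
    case 1
    note p = this
    have c: "noncrossing c" "connected_part c" "components cs" using p(1) by (auto simp: components_def)
    have le: "\<forall>y\<in>set (B @ st). y \<le> N" using p(4-6) by auto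
    have nb: "max N (nblocks (map (\<lambda>x. x + N) c)) = N + nblocks c"
      using c(2) by (simp add: nblocks_map_add connected_part_def)
    have "c \<noteq> []" "hd c = 1" using c is_partition_hd
      by (cases c; auto simp: connected_part_def noncrossing_def)+
    then have "1 \<le> nblocks c" using le_nblocks[OF hd_in_set, of c] by simp
    then have "nc_extends ((Suc N # B) @ st) (N + nblocks c) (fill (N + nblocks c) u cs)"
      using p c by (intro "1.IH") auto
    then show ?case
      using noncrossing_shift[OF le c(1)] open_blocks_connected[OF c(1,2)] nb
      by (simp add: nc_extends_append)
  }
  {
    case 2
    note p = this
    have c: "noncrossing c" "connected_part c" "components cs" using p(1) by (auto simp: components_def)
    have le: "\<forall>y\<in>set (B @ st). y \<le> N" using p(4-6) by auto
    have "c \<noteq> []" "hd c = 1" using c is_partition_hd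
      by (cases c; auto simp: connected_part_def noncrossing_def)+
    then have "1 \<le> nblocks c" using le_nblocks[OF hd_in_set, of c] by simp
    then have "length (open_blocks ((Suc N # B) @ st) (fill (N + nblocks c) u cs)) =
      trailing_holes (length (Suc N # B)) u + length (open_blocks st (letters u))"
      using p c by (intro "1.IH") auto
    then show ?case
      using noncrossing_shift[OF le c(1)] open_blocks_connected[OF c(1,2)]
      by (simp add: open_blocks_append)
  }
next
  case (2 N y u cs)
  have drop: "dropWhile (\<lambda>z. y \<le> z) (B @ st) = dropWhile (\<lambda>z. y \<le> z) st"
    if "y \<le> M" "\<forall>x\<in>set B. M < x \<and> x \<le> N" for B st
    using that by (intro dropWhile_append2) auto
  {
    case 1
    note p = this
    have "y \<le> M" "y \<in> set st" using p(3,7) by auto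
    then have "nc_extends ([] @ y # dropWhile (\<lambda>z. y \<le> z) st) N (fill N u cs)"
      using p by (intro "2.IH") (auto simp: max_def dest: set_dropWhileD)
    moreover have "max N y = N" using p(4) \<open>y \<le> M\<close> by simp
    ultimately show ?case using drop[OF \<open>y \<le> M\<close> p(5)] \<open>y \<in> set st\<close> by simp
  }
  {
    case 2
    note p = this
    have "y \<le> M" "y \<in> set st" using p(3,7) by auto
    then have "length (open_blocks ([] @ y # dropWhile (\<lambda>z. y \<le> z) st) (fill N u cs)) =
      trailing_holes (length ([]::nat list)) u + length (open_blocks (y # dropWhile (\<lambda>z. y \<le> z) st) (letters u))"
      using p by (intro "2.IH") (auto simp: max_def dest: set_dropWhileD)
    then show ?case using drop[OF \<open>y \<le> M\<close> p(5)] by simp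
  }
qed auto

lemma components_exist:
  assumes "noncrossing w"
  obtains cs where "components cs" "foldl pcomp [] cs = w"
proof -
  have pos: "\<forall>x\<in>set w. 0 < x" using noncrossing_pos[OF assms] by blast
  then obtain u cs where u: "w = fill 0 u cs" "holes u = length cs" "components cs"
    "letters u = filter (\<lambda>x. x \<le> 0) w"
    using fill_exists[of "[]" w 0] assms by auto
  have "filter (\<lambda>x. 0 < x) w = foldl pcomp [] cs"
    using filter_fill[of cs u 0 0] u by auto
  then show thesis using that u(3) pos by (metis filter_True)
qed

lemma ncomp_join: "components cs \<Longrightarrow> ncomp (foldl pcomp [] cs) = length cs"
  unfolding ncomp_def
proof (rule the_equality)
  assume cs: "components cs"
  then show "\<exists>ds. length ds = length cs \<and> (\<forall>c\<in>set ds. is_partition c \<and> connected_part c)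
    \<and> foldl pcomp [] ds = foldl pcomp [] cs"
    by (auto simp: components_def noncrossing_def)
  fix m assume "\<exists>ds. length ds = m \<and> (\<forall>c\<in>set ds. is_partition c \<and> connected_part c)
    \<and> foldl pcomp [] ds = foldl pcomp [] cs"
  then show "m = length cs"
    using components_of_noncrossing components_join[OF cs] components_unique[OF cs] by metis
qed

lemma ncomp_eq_open_blocks: "noncrossing w \<Longrightarrow> ncomp w = length (open_blocks [] w)"
  by (metis components_exist components_join(2) ncomp_join)

section \<open>Extending a pattern on the left\<close>

lemma Av_nc_iff: "w \<in> Av_nc p \<longleftrightarrow> noncrossing w \<and> \<not> contains w p"
  by (auto simp: Av_nc_def noncrossing_def)

text \<open>\<open>F c q\<close> inserts \<open>q\<close> into the context \<open>c\<close>. Admissibility \<open>V\<close> of a context depends on \<open>q\<close> only through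
  \<open>ncomp q\<close>, so a bijection on the inserted partitions lifts to the whole.\<close>

lemma cc_equiv_in_context:
  fixes F :: "'c \<Rightarrow> nat list \<Rightarrow> nat list" and V :: "'c \<Rightarrow> nat \<Rightarrow> bool"
  assumes equiv: "cc_equiv p p'"
    and Av: "\<And>r. r \<in> {p, p'} \<Longrightarrow>
      Av_nc (g r) = X \<union> (\<lambda>(c, q). F c q) ` {(c, q). q \<in> Av_nc r \<and> V c (ncomp q)}"
    and fresh: "\<And>c q. noncrossing q \<Longrightarrow> V c (ncomp q) \<Longrightarrow> F c q \<notin> X"
    and inj: "\<And>c q c' q'. noncrossing q \<Longrightarrow> V c (ncomp q) \<Longrightarrow> noncrossing q' \<Longrightarrow> V c' (ncomp q') \<Longrightarrow>
      F c q = F c' q' \<Longrightarrow> c = c' \<and> q = q'"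
    and stats: "\<And>c q q'. noncrossing q \<Longrightarrow> noncrossing q' \<Longrightarrow> V c (ncomp q) \<Longrightarrow> length q = length q' \<Longrightarrow>
      ncomp q = ncomp q' \<Longrightarrow> length (F c q) = length (F c q') \<and> ncomp (F c q) = ncomp (F c q')"
  shows "cc_equiv (g p) (g p')"
proof -
  obtain f where f: "bij_betw f (Av_nc p) (Av_nc p')"
    "\<And>q. q \<in> Av_nc p \<Longrightarrow> length (f q) = length q \<and> ncomp (f q) = ncomp q"
    using equiv by (auto simp: cc_equiv_def)
  define D where "D r = {(c, q). q \<in> Av_nc r \<and> V c (ncomp q)}" for r
  define G where "G = (\<lambda>(c, q). F c q)"
  define h where "h = (\<lambda>(c::'c, q). (c, f q))"
  have injG: "inj_on G (D r)" for r
    unfolding G_def D_def by (auto intro!: inj_onI simp: Av_nc_iff dest: inj)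
  have G: "bij_betw G (D r) (G ` D r)" for r
    using injG by (simp add: bij_betw_imageI)
  have h: "bij_betw h (D p) (D p')"
  proof (rule bij_betw_imageI)
    show "inj_on h (D p)"
      using bij_betw_imp_inj_on[OF f(1)] by (auto simp: h_def D_def inj_on_def)
    have "(c, q) \<in> h ` D p" if "(c, q) \<in> D p'" for c q
    proof -
      have q: "q \<in> Av_nc p'" "V c (ncomp q)" using that by (auto simp: D_def)
      then obtain q0 where "q0 \<in> Av_nc p" "q = f q0" using bij_betw_imp_surj_on[OF f(1)] by blast
      then show ?thesis using q f(2)[of q0] by (auto simp: h_def D_def intro!: image_eqI[of _ _ "(c, q0)"])
    qed
    then show "h ` D p = D p'"
      using bij_betwE[OF f(1)] f(2) by (auto simp: h_def D_def)
  qed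
  define k where "k = G \<circ> h \<circ> inv_into (D p) G"
  have k: "bij_betw k (G ` D p) (G ` D p')"
    unfolding k_def comp_assoc
    using bij_betw_trans[OF bij_betw_trans[OF bij_betw_inv_into[OF G[of p]] h] G[of p']] .
  have kG: "k (G z) = G (h z)" if "z \<in> D p" for z
    using inv_into_f_f[OF injG that] by (simp add: k_def)
  have disj: "X \<inter> G ` D r = {}" for r
    using fresh by (auto simp: G_def D_def Av_nc_iff)
  define K where "K w = (if w \<in> X then w else k w)" for w
  have "bij_betw K X X"
    by (rule bij_betw_cong[THEN iffD1, OF _ bij_betw_id]) (simp add: K_def)
  moreover have "bij_betw K (G ` D p) (G ` D p')"
    using disj[of p] by (intro bij_betw_cong[THEN iffD1, OF _ k]) (auto simp: K_def)
  ultimately have "bij_betw K (X \<union> G ` D p) (X \<union> G ` D p')"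
    using disj by (intro bij_betw_combine) auto
  then have "bij_betw K (Av_nc (g p)) (Av_nc (g p'))"
    using Av[of p] Av[of p'] by (simp add: G_def D_def)
  moreover have "length (K w) = length w \<and> ncomp (K w) = ncomp w" if w_Av: "w \<in> Av_nc (g p)" for w
  proof (cases "w \<in> X")
    case False
    then obtain c q where w: "w = F c q" and q: "q \<in> Av_nc p" "V c (ncomp q)"
      using w_Av Av[of p] by auto
    have "(c, q) \<in> D p" using q by (simp add: D_def)
    then have "K w = F c (f q)" using kG[of "(c, q)"] False by (simp add: K_def w G_def h_def)
    moreover have "f q \<in> Av_nc p'" using bij_betwE[OF f(1)] q(1) by blast
    ultimately show ?thesis using stats[of "f q" q c] f(2)[OF q(1)] q w by (auto simp: Av_nc_iff)
  qed (simp add: K_def)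
  ultimately show ?thesis unfolding cc_equiv_def by blast
qed

definition minimal_prefix :: "nat list \<Rightarrow> nat list \<Rightarrow> bool" where
  "minimal_prefix p P \<longleftrightarrow> contains P p \<and> \<not> contains (butlast P) p"

lemma minimal_prefix_exists:
  assumes "contains w p" "p \<noteq> []"
  obtains P S where "w = P @ S" "minimal_prefix p P"
proof -
  define n where "n = (LEAST n. contains (take n w) p)"
  have n: "contains (take n w) p" unfolding n_def by (rule LeastI[of _ "length w"]) (simp add: assms)
  have "n \<le> length w" unfolding n_def by (rule Least_le) (simp add: assms)
  moreover have "n \<noteq> 0" using n assms(2) contains_Nil_left by (metis take_0)
  moreover have "\<not> contains (take (n - 1) w) p"
    using not_less_Least[of "n - 1" "\<lambda>n. contains (take n w) p"] \<open>n \<noteq> 0\<close> by (simp add: n_def)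
  ultimately have "minimal_prefix p (take n w)" using n by (simp add: minimal_prefix_def butlast_take)
  then show thesis using that[of "take n w" "drop n w"] by simp
qed

lemma minimal_prefix_le:
  assumes "minimal_prefix p P" "contains w p" "P @ S = w @ w'"
  shows "prefix P w"
proof (cases "length P \<le> length w")
  case True
  then show ?thesis using assms(3) by (auto simp: append_eq_append_conv2)
next
  case False
  then obtain r where "P = w @ r" "r \<noteq> []" using assms(3) by (auto simp: append_eq_append_conv2)
  then have "butlast P = w @ butlast r" by (simp add: butlast_append)
  then have "contains (butlast P) p" using contains_subseq[OF assms(2)] by (simp add: subseq_rev_drop_many)
  then show ?thesis using assms(1) by (simp add: minimal_prefix_def)
qed

lemma minimal_prefix_unique:
  assumes "minimal_prefix p P" "minimal_prefix p P'" "P @ S = P' @ S'"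
  shows "P = P'"
  using minimal_prefix_le[OF assms(1) _ assms(3)] minimal_prefix_le[OF assms(2) _ assms(3)[symmetric]]
    assms(1,2) by (simp add: minimal_prefix_def prefix_order.antisym)

lemma contains_pcomp_minimal_prefix:
  assumes nc: "noncrossing (P @ S)" and P: "minimal_prefix p P" "p \<noteq> []" and q: "is_partition q"
  shows "contains (P @ S) (pcomp p q) \<longleftrightarrow> contains (filter (\<lambda>x. nblocks P < x) S) q"
proof -
  have pos: "\<forall>x\<in>set (P @ S). 0 < x" "\<forall>x\<in>set q. 0 < x"
    using noncrossing_pos[OF nc] is_partition_pos[OF q] by blast+
  show ?thesis
  proof
    assume "contains (P @ S) (pcomp p q)"
    then obtain w1 w2 k where w: "P @ S = w1 @ w2" "contains (filter (\<lambda>x. x \<le> k) w1) p"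
      "contains (filter (\<lambda>x. k < x) w2) q"
      unfolding contains_pcomp[OF pos] by blast
    have "contains w1 p" using w(2) contains_subseq subseq_filter_left by blast
    then obtain r where r: "w1 = P @ r" using minimal_prefix_le[OF P(1) _ w(1)] by (auto elim: prefixE)
    have "P \<noteq> []" using P by (auto simp: minimal_prefix_def contains_Nil_left)
    then have w1: "w1 = butlast P @ (last P # r)" using r by simp
    have "filter (\<lambda>x. x \<le> k) (last P # r) \<noteq> []"
    proof
      assume "filter (\<lambda>x. x \<le> k) (last P # r) = []"
      then have "contains (filter (\<lambda>x. x \<le> k) (butlast P)) p" using w(2) unfolding w1 filter_append by simp
      then have "contains (butlast P) p" using contains_subseq subseq_filter_left by blast
      then show False using P by (simp add: minimal_prefix_def)
    qed
    then obtain x where x: "x \<in> set (last P # r)" "x \<le> k" unfolding filter_empty_conv by blast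
    have "nblocks P < y" if y: "y \<in> set w2" "k < y" for y
    proof (rule ccontr)
      assume "\<not> nblocks P < y"
      then have "y \<in> set P"
        using is_partition_surj[of P y] is_partition_appendD[of P S] nc y by (auto simp: noncrossing_def)
      then obtain a b where ab: "P = a @ y # b" by (auto simp: in_set_conv_decomp)
      have "x \<in> set (b @ r)"
        using x y ab by (cases b rule: rev_cases) auto
      then obtain c d where cd: "b @ r = c @ x # d" using split_list by metis
      have "P @ S = a @ y # c @ x # (d @ w2)" using w(1) r ab cd by simp
      then show False using noncrossing_no_return[of a y c x "d @ w2"] nc x y by auto
    qed
    then have "filter (\<lambda>x. k < x) w2 = filter (\<lambda>x. k < x) (filter (\<lambda>x. nblocks P < x) w2)"
      by (auto intro: filter_cong)
    then have "contains (filter (\<lambda>x. nblocks P < x) w2) q"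
      using w(3) contains_subseq subseq_filter_left by metis
    moreover have "S = r @ w2" using w(1) r by simp
    ultimately show "contains (filter (\<lambda>x. nblocks P < x) S) q"
      using contains_subseq[of _ q] by (simp add: subseq_drop_many)
  next
    assume "contains (filter (\<lambda>x. nblocks P < x) S) q"
    moreover have "filter (\<lambda>x. x \<le> nblocks P) P = P" by (simp add: filter_id_conv le_nblocks)
    ultimately show "contains (P @ S) (pcomp p q)"
      unfolding contains_pcomp[OF pos] using P(1) unfolding minimal_prefix_def by metis
  qed
qed

lemma Av_nc_pcomp_leftI: "is_partition q \<Longrightarrow> w \<in> Av_nc p \<Longrightarrow> w \<in> Av_nc (pcomp p q)"
  using contains_pcomp[of w q p] is_partition_pos[of q] noncrossing_pos[of w]
  by (auto simp: Av_nc_iff) (meson contains_subseq subseq_filter_left subseq_rev_drop_many)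

lemma Av_nc_pcomp_rightI: "is_partition q \<Longrightarrow> w \<in> Av_nc q \<Longrightarrow> w \<in> Av_nc (pcomp p q)"
  using contains_pcomp[of w q p] is_partition_pos[of q] noncrossing_pos[of w]
  by (auto simp: Av_nc_iff) (meson contains_subseq subseq_filter_left subseq_drop_many)

definition decomposition :: "nat list \<Rightarrow> nat list list" where
  "decomposition w = (SOME cs. components cs \<and> foldl pcomp [] cs = w)"

lemma decomposition:
  assumes "noncrossing w"
  shows "components (decomposition w)" "foldl pcomp [] (decomposition w) = w"
    "length (decomposition w) = ncomp w"
proof -
  obtain cs where "components cs \<and> foldl pcomp [] cs = w"
    using components_exist[OF assms] by metis
  then have "components (decomposition w) \<and> foldl pcomp [] (decomposition w) = w"
    unfolding decomposition_def by (rule someI)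
  then show "components (decomposition w)" "foldl pcomp [] (decomposition w) = w" by auto
  then show "length (decomposition w) = ncomp w" using ncomp_join[of "decomposition w"] by simp
qed

lemma decomposition_join: "components cs \<Longrightarrow> decomposition (foldl pcomp [] cs) = cs"
  using components_unique[of "decomposition (foldl pcomp [] cs)" cs]
    decomposition[OF components_join(1)[of cs]] by simp

definition left_context :: "nat list \<Rightarrow> nat list \<times> nat option list \<Rightarrow> nat \<Rightarrow> bool" where
  "left_context p = (\<lambda>(P, u) k. noncrossing P \<and> minimal_prefix p P \<and> holes u = k \<and>
     (\<forall>x\<in>set (letters u). x \<le> nblocks P) \<and> nc_extends (open_blocks [] P) (nblocks P) (letters u))"

definition left_fill :: "nat list \<times> nat option list \<Rightarrow> nat list \<Rightarrow> nat list" where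
  "left_fill = (\<lambda>(P, u) q. P @ fill (nblocks P) u (decomposition q))"

lemma left_fill:
  assumes "noncrossing q" "left_context p (P, u) (ncomp q)"
  shows "noncrossing (left_fill (P, u) q)"
    "ncomp (left_fill (P, u) q) = trailing_holes 0 u + length (open_blocks (open_blocks [] P) (letters u))"
    "length (left_fill (P, u) q) = length P + length (letters u) + length q"
    "filter (\<lambda>x. nblocks P < x) (fill (nblocks P) u (decomposition q)) = map (\<lambda>x. x + nblocks P) q"
proof -
  note d = decomposition[OF assms(1)]
  have P: "noncrossing P" and u: "holes u = length (decomposition q)"
    "\<forall>x\<in>set (letters u). x \<le> nblocks P" "nc_extends (open_blocks [] P) (nblocks P) (letters u)"
    using assms(2) d(3) by (auto simp: left_context_def)
  note fill = nc_extends_fill[OF d(1) u(1,2) order_refl _ open_blocks_le_nblocks u(3), of "[]", simplified]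
  show nc: "noncrossing (left_fill (P, u) q)"
    using P fill by (simp add: left_fill_def noncrossing_append)
  show "ncomp (left_fill (P, u) q) = trailing_holes 0 u + length (open_blocks (open_blocks [] P) (letters u))"
    using fill unfolding ncomp_eq_open_blocks[OF nc] by (simp add: left_fill_def open_blocks_append)
  show "length (left_fill (P, u) q) = length P + length (letters u) + length q"
    using length_fill[OF u(1)] d(2) by (simp add: left_fill_def)
  show "filter (\<lambda>x. nblocks P < x) (fill (nblocks P) u (decomposition q)) = map (\<lambda>x. x + nblocks P) q"
    using filter_fill[OF d(1) u(1,2) order_refl] d(2) by simp
qed

lemma contains_left_fill:
  assumes "noncrossing q" "left_context p (P, u) (ncomp q)" "p \<noteq> []" "is_partition r"
  shows "contains (left_fill (P, u) q) (pcomp p r) \<longleftrightarrow> contains q r"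
  using contains_pcomp_minimal_prefix[of P _ p r] left_fill(1,4)[OF assms(1,2)] assms
  by (simp add: left_context_def left_fill_def)

lemma left_fill_exists:
  assumes "noncrossing w" "contains w p" "p \<noteq> []"
  obtains P u q where "w = left_fill (P, u) q" "noncrossing q" "left_context p (P, u) (ncomp q)"
proof -
  obtain P S where PS: "w = P @ S" "minimal_prefix p P" using minimal_prefix_exists assms by blast
  obtain u cs where u: "S = fill (nblocks P) u cs" "holes u = length cs" "components cs"
    "letters u = filter (\<lambda>x. x \<le> nblocks P) S"
    using fill_exists[of P S "nblocks P"] assms(1) PS(1) by fastforce
  have P: "noncrossing P" using assms(1) PS(1) by (simp add: noncrossing_append)
  have "is_partition (P @ filter (\<lambda>x. x \<le> nblocks P) S)"
  proof -
    have "\<forall>x\<in>set S. 0 < x" using noncrossing_pos[OF assms(1)] PS(1) by auto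
    then show ?thesis
    proof (induction S rule: rev_induct)
      case (snoc x S)
      have "nblocks (P @ filter (\<lambda>x. x \<le> nblocks P) S) \<ge> nblocks P" by simp
      then show ?case using snoc is_partition_snoc[of "P @ filter (\<lambda>x. x \<le> nblocks P) S" x] by auto
    qed (use P in \<open>simp add: noncrossing_def\<close>)
  qed
  moreover have "subseq (P @ filter (\<lambda>x. x \<le> nblocks P) S) w"
    unfolding PS(1) by (intro list_emb_append_mono) auto
  ultimately have "noncrossing (P @ letters u)"
    using assms(1) contains_subseq unfolding u(4) noncrossing_def by blast
  then have "left_context p (P, u) (ncomp (foldl pcomp [] cs))"
    using P PS(2) u by (simp add: left_context_def ncomp_join noncrossing_append)
  moreover have "w = left_fill (P, u) (foldl pcomp [] cs)"
    using PS(1) u(1) by (simp add: left_fill_def decomposition_join[OF u(3)])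
  ultimately show thesis using that components_join(1)[OF u(3)] by blast
qed

lemma left_fill_inject:
  assumes "noncrossing q" "left_context p (P, u) (ncomp q)"
    "noncrossing q'" "left_context p (P', u') (ncomp q')"
    "left_fill (P, u) q = left_fill (P', u') q'"
  shows "P = P' \<and> u = u' \<and> q = q'"
proof -
  have P: "P = P'"
    using minimal_prefix_unique assms(2,4,5) unfolding left_context_def left_fill_def by auto
  then have eq: "fill (nblocks P) u (decomposition q) = fill (nblocks P) u' (decomposition q')"
    using assms(5) by (simp add: left_fill_def)
  then have "map (\<lambda>x. x + nblocks P) q = map (\<lambda>x. x + nblocks P) q'"
    using left_fill(4)[OF assms(1,2)] left_fill(4)[OF assms(3,4)] P by simp
  then have q: "q = q'" by (simp add: inj_map_eq_map)
  then have "u = u'"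
    using eq decomposition[OF assms(1)] assms(2,4) P
    by (intro fill_inject[of "decomposition q" u u' "nblocks P" "nblocks P"]) (auto simp: left_context_def)
  then show ?thesis using P q by blast
qed

lemma cc_equiv_pcomp_left:
  assumes "cc_equiv \<rho> \<rho>'" "is_partition \<rho>" "is_partition \<rho>'"
  shows "cc_equiv (pcomp \<sigma> \<rho>) (pcomp \<sigma> \<rho>')"
proof (cases "\<sigma> = []")
  case False
  show ?thesis
  proof (rule cc_equiv_in_context[where F = left_fill and V = "left_context \<sigma>" and X = "Av_nc \<sigma>"
        and g = "pcomp \<sigma>", OF assms(1)])
    fix r assume "r \<in> {\<rho>, \<rho>'}"
    then have r: "is_partition r" using assms by auto
    show "Av_nc (pcomp \<sigma> r) =
      Av_nc \<sigma> \<union> (\<lambda>(c, q). left_fill c q) ` {(c, q). q \<in> Av_nc r \<and> left_context \<sigma> c (ncomp q)}" (is "_ = ?R")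
    proof
      show "Av_nc (pcomp \<sigma> r) \<subseteq> ?R"
      proof
        fix w assume w: "w \<in> Av_nc (pcomp \<sigma> r)"
        show "w \<in> ?R"
        proof (cases "contains w \<sigma>")
          case True
          then obtain P u q where q: "w = left_fill (P, u) q" "noncrossing q" "left_context \<sigma> (P, u) (ncomp q)"
            using left_fill_exists[OF _ True False] w unfolding Av_nc_iff by metis
          then have "q \<in> Av_nc r" using contains_left_fill[OF q(2,3) False r] w by (auto simp: Av_nc_iff)
          then show ?thesis using q by (auto intro!: image_eqI[of _ _ "((P, u), q)"])
        qed (use w in \<open>simp add: Av_nc_iff\<close>)
      qed
      show "?R \<subseteq> Av_nc (pcomp \<sigma> r)"
        using Av_nc_pcomp_leftI[OF r] left_fill(1) contains_left_fill[OF _ _ False r] by (auto simp: Av_nc_iff)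
    qed
  next
    fix c q assume "noncrossing q" "left_context \<sigma> c (ncomp q)"
    then have "contains (left_fill c q) \<sigma>"
      using contains_subseq[of "fst c" \<sigma>]
      by (auto simp: left_context_def left_fill_def minimal_prefix_def subseq_rev_drop_many)
    then show "left_fill c q \<notin> Av_nc \<sigma>" by (simp add: Av_nc_iff)
  next
    fix c q c' q'
    assume "noncrossing q" "left_context \<sigma> c (ncomp q)" "noncrossing q'" "left_context \<sigma> c' (ncomp q')"
      "left_fill c q = left_fill c' q'"
    then show "c = c' \<and> q = q'" using left_fill_inject by (cases c; cases c') blast
  next
    fix c q q'
    assume "noncrossing q" "noncrossing q'" "left_context \<sigma> c (ncomp q)" "length q = length q'" "ncomp q = ncomp q'"
    then show "length (left_fill c q) = length (left_fill c q') \<and> ncomp (left_fill c q) = ncomp (left_fill c q')"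
      using left_fill(2,3) by (cases c) auto
  qed
qed (use assms in simp)

section \<open>Extending a pattern on the right\<close>

definition marked_split :: "nat list \<Rightarrow> nat list \<Rightarrow> nat list \<Rightarrow> bool" where
  "marked_split p Q S \<longleftrightarrow> S \<noteq> [] \<and> hd S = Suc (nblocks Q) \<and>
     contains (filter (\<lambda>x. nblocks Q < x) S) p \<and> \<not> contains (filter (\<lambda>x. Suc (nblocks Q) < x) S) p"

lemma filter_gt_nblocks: "nblocks Q \<le> n \<Longrightarrow> filter (\<lambda>x. n < x) (Q @ S) = filter (\<lambda>x. n < x) S"
  using le_nblocks[of _ Q] by (fastforce simp: filter_empty_conv)

lemma contains_filter_mono:
  assumes "contains (filter (\<lambda>x. n < x) w) p" "m \<le> (n::nat)"
  shows "contains (filter (\<lambda>x. m < x) w) p"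
proof -
  have "filter (\<lambda>x. n < x) w = filter (\<lambda>x. n < x) (filter (\<lambda>x. m < x) w)"
    using assms(2) by (auto intro: filter_cong)
  then show ?thesis using assms(1) contains_subseq subseq_filter_left by metis
qed

lemma marked_split_max:
  assumes "marked_split p Q S" "contains (filter (\<lambda>x. n < x) (Q @ S)) p"
  shows "n \<le> nblocks Q"
proof (rule ccontr)
  assume "\<not> n \<le> nblocks Q"
  then have "contains (filter (\<lambda>x. Suc (nblocks Q) < x) (Q @ S)) p"
    using contains_filter_mono[OF assms(2)] by simp
  moreover have "filter (\<lambda>x. Suc (nblocks Q) < x) (Q @ S) = filter (\<lambda>x. Suc (nblocks Q) < x) S"
    by (rule filter_gt_nblocks) simp
  ultimately show False using assms(1) by (simp add: marked_split_def)
qed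

lemma marked_split_unique:
  assumes "marked_split p Q S" "marked_split p Q' S'" "Q @ S = Q' @ S'"
  shows "Q = Q'"
proof -
  have c: "contains (filter (\<lambda>x. nblocks Q < x) (Q @ S)) p"
    "contains (filter (\<lambda>x. nblocks Q' < x) (Q' @ S')) p"
    using assms(1,2) filter_gt_nblocks by (auto simp: marked_split_def)
  then have n: "nblocks Q = nblocks Q'"
    using marked_split_max[OF assms(1), of "nblocks Q'"] marked_split_max[OF assms(2), of "nblocks Q"]
      assms(3) by simp
  have tw: "takeWhile (\<lambda>x. x \<le> nblocks Q) (Q @ S) = Q" if "marked_split p Q S" for Q S
    using that by (cases S) (auto simp: marked_split_def le_nblocks)
  show ?thesis using tw[OF assms(1)] tw[OF assms(2)] unfolding n assms(3) by (rule trans[OF sym])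
qed

lemma marked_split_exists:
  assumes "is_partition w" "contains w p" "p \<noteq> []"
  obtains Q S where "w = Q @ S" "marked_split p Q S"
proof -
  define m where "m = (LEAST m. \<not> contains (filter (\<lambda>x. m < x) w) p)"
  have "filter (\<lambda>x. nblocks w < x) w = []" by (auto simp: filter_empty_conv not_less le_nblocks)
  then have "\<not> contains (filter (\<lambda>x. nblocks w < x) w) p" using assms(3) by (simp add: contains_Nil_left)
  then have m: "\<not> contains (filter (\<lambda>x. m < x) w) p" unfolding m_def by (rule LeastI)
  have "filter (\<lambda>x. 0 < x) w = w" using is_partition_pos[OF assms(1)] by (simp add: filter_id_conv)
  then have "m \<noteq> 0" using m assms(2) by metis
  then obtain n where n: "m = Suc n" by (cases m) auto
  have cn: "contains (filter (\<lambda>x. n < x) w) p"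
    using not_less_Least[of n "\<lambda>m. \<not> contains (filter (\<lambda>x. m < x) w) p"] n by (simp add: m_def)
  define Q S where "Q = takeWhile (\<lambda>x. x \<le> n) w" and "S = dropWhile (\<lambda>x. x \<le> n) w"
  have w: "w = Q @ S" by (simp add: Q_def S_def)
  have le: "\<forall>x\<in>set Q. x \<le> n" by (auto simp: Q_def dest: set_takeWhileD)
  then have nb: "nblocks Q \<le> n" using nblocks_in_set[of Q] by (cases "Q = []") auto
  have S: "S \<noteq> []"
  proof
    assume "S = []"
    then have "filter (\<lambda>x. n < x) w = []" using w le by (auto simp: filter_empty_conv not_less)
    then show False using cn assms(3) by (simp add: contains_Nil_left)
  qed
  then have "n < hd S" unfolding S_def using hd_dropWhile[of "\<lambda>x. x \<le> n" w] by simp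
  moreover have "is_partition (Q @ [hd S])"
    using is_partition_appendD[of "Q @ [hd S]" "tl S"] assms(1) w S by simp
  ultimately have hd: "hd S = Suc n" "nblocks Q = n" using nb by (auto simp: is_partition_snoc)
  have "marked_split p Q S"
    using S hd m cn n filter_gt_nblocks[of Q n S] filter_gt_nblocks[of Q "Suc n" S]
    unfolding marked_split_def w by simp
  then show thesis using that w by blast
qed

lemma contains_pcomp_marked_split:
  assumes nc: "noncrossing (Q @ S)" and split: "marked_split q Q S" and q: "is_partition q" "q \<noteq> []"
  shows "contains (Q @ S) (pcomp p q) \<longleftrightarrow> contains Q p"
proof -
  have pos: "\<forall>x\<in>set (Q @ S). 0 < x" "\<forall>x\<in>set q. 0 < x"
    using noncrossing_pos[OF nc] is_partition_pos[OF q(1)] by blast+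
  show ?thesis
  proof
    assume "contains (Q @ S) (pcomp p q)"
    then obtain w1 w2 k where w: "Q @ S = w1 @ w2" "contains (filter (\<lambda>x. x \<le> k) w1) p"
      "contains (filter (\<lambda>x. k < x) w2) q"
      unfolding contains_pcomp[OF pos] by blast
    obtain m where m: "m \<in> set (filter (\<lambda>x. k < x) w2)"
      "contains (filter (\<lambda>x. m \<le> x) (filter (\<lambda>x. k < x) w2)) q"
      using contains_filter_ge_hd[OF w(3) q] by blast
    then have km: "k < m" "m \<in> set w2" by auto
    have "filter (\<lambda>x. m \<le> x) (filter (\<lambda>x. k < x) w2) = filter (\<lambda>x. m - 1 < x) w2"
      using km(1) by (auto intro: filter_cong)
    then have "contains (filter (\<lambda>x. m - 1 < x) (Q @ S)) q"
      using m(2) contains_subseq unfolding w(1) filter_append by (metis list_emb_append2 subseq_order.refl)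
    then have mle: "m \<le> Suc (nblocks Q)" using marked_split_max[OF split] by fastforce
    show "contains Q p"
    proof (cases "length w1 \<le> length Q")
      case True
      then obtain r where "Q = w1 @ r" using w(1) by (auto simp: append_eq_append_conv2)
      then have "subseq (filter (\<lambda>x. x \<le> k) w1) Q"
        by (simp add: subseq_rev_drop_many)
      then show ?thesis using contains_subseq w(2) by blast
    next
      case False
      then obtain r where r: "w1 = Q @ r" "S = r @ w2" "r \<noteq> []"
        using w(1) by (auto simp: append_eq_append_conv2)
      then obtain r' where r': "r = Suc (nblocks Q) # r'"
        using split by (cases r) (auto simp: marked_split_def)
      have "\<not> y \<le> k" if y: "y \<in> set r" for y
      proof
        assume "y \<le> k"
        then have "y \<in> set r'" using y r' km mle by auto
        then obtain c d where cd: "r' = c @ y # d" by (auto simp: in_set_conv_decomp)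
        have "is_partition (Q @ [Suc (nblocks Q)])"
          using is_partition_appendD[of "Q @ [Suc (nblocks Q)]" "r' @ w2"] nc r r' by (simp add: noncrossing_def)
        then have "m \<in> set (Q @ [Suc (nblocks Q)])"
          using is_partition_surj[of "Q @ [Suc (nblocks Q)]" m] mle km by simp
        then obtain a b where ab: "Q @ [Suc (nblocks Q)] = a @ m # b" using split_list by metis
        have "Q @ S = (Q @ [Suc (nblocks Q)]) @ c @ y # d @ w2" using r r' cd by simp
        also have "\<dots> = a @ m # (b @ c) @ y # (d @ w2)" unfolding ab by simp
        finally show False
          using noncrossing_no_return[of a m "b @ c" y "d @ w2"] nc km \<open>y \<le> k\<close> by simp
      qed
      then have "filter (\<lambda>x. x \<le> k) w1 = filter (\<lambda>x. x \<le> k) Q"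
        using r(1) by (auto simp: filter_empty_conv)
      then show ?thesis using w(2) contains_subseq subseq_filter_left by metis
    qed
  next
    assume "contains Q p"
    moreover have "filter (\<lambda>x. x \<le> nblocks Q) Q = Q" by (simp add: filter_id_conv le_nblocks)
    ultimately show "contains (Q @ S) (pcomp p q)"
      unfolding contains_pcomp[OF pos] using split unfolding marked_split_def by metis
  qed
qed

text \<open>The order-preserving map that sends the stack \<open>1, ..., k\<close> of the partition \<open>12...k\<close> to the stack of
  \<open>Q\<close>, and the letters above \<open>k\<close> to those not occurring in \<open>Q\<close>. The value at \<open>0\<close> is junk.\<close>

definition rename :: "nat list \<Rightarrow> nat \<Rightarrow> nat" where
  "rename Q x = (let st = open_blocks [] Q in
     if x \<le> length st then rev st ! (x - 1) else x - length st + nblocks Q)"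

definition canonical_stack :: "nat \<Rightarrow> nat list" where
  "canonical_stack k = rev [1..<Suc k]"

lemma canonical_stack_bounds: "\<forall>y\<in>set (canonical_stack k). 0 < y \<and> y \<le> k"
  by (auto simp: canonical_stack_def)

lemma rename_le:
  assumes "0 < x" "x \<le> length (open_blocks [] Q)"
  shows "rename Q x \<in> set (open_blocks [] Q)"
proof -
  have "rev (open_blocks [] Q) ! (x - 1) \<in> set (rev (open_blocks [] Q))" using assms by (intro nth_mem) simp
  then show ?thesis using assms by (simp add: rename_def Let_def)
qed

lemma rename_gt: "length (open_blocks [] Q) < x \<Longrightarrow> rename Q x = x - length (open_blocks [] Q) + nblocks Q"
  by (simp add: rename_def Let_def)

lemma rename_less:
  assumes "0 < x" "x < y"
  shows "rename Q x < rename Q y"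
proof -
  let ?st = "open_blocks [] Q"
  consider "y \<le> length ?st" | "x \<le> length ?st" "length ?st < y" | "length ?st < x" by linarith
  then show ?thesis
  proof cases
    case 1
    have "sorted_wrt (<) (rev ?st)" using sorted_open_blocks[of "[]" Q] by (simp add: sorted_wrt_rev)
    then show ?thesis using 1 assms sorted_wrt_nth_less[of "(<)" "rev ?st" "x - 1" "y - 1"]
      by (simp add: rename_def Let_def)
  next
    case 2
    then show ?thesis
      using rename_le[OF assms(1), of Q] open_blocks_le_nblocks[of Q] rename_gt[of Q y] by fastforce
  next
    case 3
    then show ?thesis using assms by (simp add: rename_gt)
  qed
qed

lemma rename_le_iff: "0 < x \<Longrightarrow> 0 < y \<Longrightarrow> rename Q x \<le> rename Q y \<longleftrightarrow> x \<le> y"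
  by (metis rename_less leD leI order_le_less)

lemma rename_eq_iff: "0 < x \<Longrightarrow> 0 < y \<Longrightarrow> rename Q x = rename Q y \<longleftrightarrow> x = y"
  by (metis rename_less nat_neq_iff)

lemma map_rename_canonical_stack:
  "map (rename Q) (canonical_stack (length (open_blocks [] Q))) = open_blocks [] Q"
proof -
  have "map (rename Q) [1..<Suc (length (open_blocks [] Q))] = rev (open_blocks [] Q)"
    by (rule nth_equalityI) (simp_all add: rename_def Let_def del: upt_Suc)
  then show ?thesis by (simp add: canonical_stack_def del: upt_Suc flip: rev_map)
qed

lemma rename_surj:
  assumes "y \<in> set (open_blocks [] Q) \<or> nblocks Q < y"
  obtains x where "0 < x" "y = rename Q x"
proof (cases "nblocks Q < y")
  case True
  then show thesis
    using that[of "y - nblocks Q + length (open_blocks [] Q)"] by (simp add: rename_gt)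
next
  case False
  then have "y \<in> rename Q ` set (canonical_stack (length (open_blocks [] Q)))"
    using assms map_rename_canonical_stack[of Q] by (metis set_map)
  then obtain x where "x \<in> set (canonical_stack (length (open_blocks [] Q)))" "y = rename Q x" by blast
  then show thesis using that[of x] canonical_stack_bounds by blast
qed

lemma dropWhile_rename:
  assumes "0 < x" "\<forall>y\<in>set st. 0 < y"
  shows "dropWhile (\<lambda>y. rename Q x \<le> y) (map (rename Q) st) = map (rename Q) (dropWhile (\<lambda>y. x \<le> y) st)"
  using assms by (induction st) (auto simp: rename_le_iff)

lemma open_blocks_rename:
  assumes "\<forall>y\<in>set st. 0 < y" "\<forall>y\<in>set w. 0 < y"
  shows "open_blocks (map (rename Q) st) (map (rename Q) w) = map (rename Q) (open_blocks st w)"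
  using assms
proof (induction w arbitrary: st)
  case (Cons x w)
  have "\<forall>y\<in>set (x # dropWhile (\<lambda>y. x \<le> y) st). 0 < y" using Cons.prems by (auto dest: set_dropWhileD)
  then show ?case using Cons.IH[of "x # dropWhile (\<lambda>y. x \<le> y) st"] Cons.prems by (simp add: dropWhile_rename)
qed simp

lemma nc_extends_rename:
  assumes "\<forall>y\<in>set st. 0 < y \<and> y \<le> n" "\<forall>y\<in>set w. 0 < y" "length (open_blocks [] Q) \<le> n"
  shows "nc_extends (map (rename Q) st) (n - length (open_blocks [] Q) + nblocks Q) (map (rename Q) w) \<longleftrightarrow>
    nc_extends st n w"
  using assms
proof (induction w arbitrary: st n)
  case (Cons x w)
  let ?f = "\<lambda>n. n - length (open_blocks [] Q) + nblocks Q"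
  have Suc: "rename Q (Suc n) = Suc (?f n)" using Cons.prems(3) by (simp add: rename_gt)
  have eq: "rename Q x = Suc (?f n) \<longleftrightarrow> x = Suc n"
    using rename_eq_iff[of x "Suc n" Q] Suc Cons.prems(2) by simp
  have mem: "rename Q x \<in> set (map (rename Q) st) \<longleftrightarrow> x \<in> set st"
  proof
    assume "rename Q x \<in> set (map (rename Q) st)"
    then obtain y where "y \<in> set st" "rename Q x = rename Q y" by auto
    then show "x \<in> set st" using rename_eq_iff[of x y Q] Cons.prems(1,2) by auto
  qed simp
  show ?case
  proof (cases "x = Suc n \<or> x \<in> set st")
    case True
    then have x: "0 < x" "x \<le> Suc n" using Cons.prems by auto
    have st: "\<forall>y\<in>set (x # dropWhile (\<lambda>y. x \<le> y) st). 0 < y \<and> y \<le> max n x"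
      using x Cons.prems(1) by (auto simp: le_max_iff_disj dest: set_dropWhileD)
    have "max (?f n) (rename Q x) = ?f (max n x)"
    proof (cases "x = Suc n")
      case False
      then have "rename Q x < rename Q (Suc n)" using x by (intro rename_less) auto
      then have "rename Q x \<le> ?f n" "x \<le> n" using False x Suc by simp_all
      then show ?thesis by (simp add: max_absorb1)
    qed (use Suc Cons.prems(3) in simp)
    then show ?thesis using Cons.IH[OF st] Cons.prems eq mem dropWhile_rename[of x st Q] x by simp
  qed (use eq mem in simp)
qed simp

lemma nc_extends_letters: "nc_extends st n w \<Longrightarrow> x \<in> set w \<Longrightarrow> x \<in> set st \<or> n < x"
proof (induction w arbitrary: st n)
  case (Cons y w)
  then show ?case using set_dropWhileD[of x "\<lambda>z. y \<le> z" st] by fastforce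
qed simp

lemma contains_filter_rename:
  assumes "\<forall>x\<in>set d. 0 < x"
  shows "contains (filter (\<lambda>x. nblocks Q + j < x) (map (rename Q) d)) p \<longleftrightarrow>
    contains (filter (\<lambda>x. length (open_blocks [] Q) + j < x) d) p"
proof -
  let ?c = "length (open_blocks [] Q)"
  have iff: "nblocks Q + j < rename Q x \<longleftrightarrow> ?c + j < x" if "0 < x" for x
  proof (cases "x \<le> ?c")
    case True
    then have "rename Q x \<le> nblocks Q" using rename_le[OF that] open_blocks_le_nblocks by blast
    then show ?thesis using True by simp
  next
    case False
    then show ?thesis by (auto simp: rename_gt)
  qed
  then have "filter (\<lambda>x. nblocks Q + j < x) (map (rename Q) d) = map (rename Q) (filter (\<lambda>x. ?c + j < x) d)"
    using assms by (auto simp: filter_map intro!: arg_cong[of _ _ "map (rename Q)"] filter_cong)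
  also have "\<dots> = map (\<lambda>x. x + nblocks Q) (map (\<lambda>x. x - ?c) (filter (\<lambda>x. ?c + j < x) d))"
    by (auto simp: rename_gt)
  finally have "contains (filter (\<lambda>x. nblocks Q + j < x) (map (rename Q) d)) p \<longleftrightarrow>
    contains (map (\<lambda>x. x - ?c) (filter (\<lambda>x. ?c + j < x) d)) p" by (simp only: contains_map_add)
  moreover have "map (\<lambda>x. x + ?c) (map (\<lambda>x. x - ?c) (filter (\<lambda>x. ?c + j < x) d)) = filter (\<lambda>x. ?c + j < x) d"
    by (rule map_diff_add) auto
  ultimately show ?thesis by (metis contains_map_add)
qed

definition right_context :: "nat list \<Rightarrow> nat list \<Rightarrow> nat \<Rightarrow> bool" where
  "right_context p d k \<longleftrightarrow> nc_extends (canonical_stack k) k d \<and> d \<noteq> [] \<and> hd d = Suc k \<and>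
     contains (filter (\<lambda>x. k < x) d) p \<and> \<not> contains (filter (\<lambda>x. Suc k < x) d) p"

definition right_fill :: "nat list \<Rightarrow> nat list \<Rightarrow> nat list" where
  "right_fill d Q = Q @ map (rename Q) d"

lemma right_context_pos: "right_context p d k \<Longrightarrow> \<forall>x\<in>set d. 0 < x"
  using nc_extends_letters canonical_stack_bounds unfolding right_context_def by fastforce

lemma nc_extends_canonical_stack:
  assumes "\<forall>x\<in>set d. 0 < x"
  shows "nc_extends (open_blocks [] Q) (nblocks Q) (map (rename Q) d) \<longleftrightarrow>
    nc_extends (canonical_stack (length (open_blocks [] Q))) (length (open_blocks [] Q)) d"
  using nc_extends_rename[OF canonical_stack_bounds assms order_refl]
  by (simp add: map_rename_canonical_stack)

lemma marked_split_rename: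
  assumes "\<forall>x\<in>set d. 0 < x" "noncrossing Q"
  shows "noncrossing (right_fill d Q) \<and> marked_split p Q (map (rename Q) d) \<longleftrightarrow> right_context p d (ncomp Q)"
proof -
  let ?c = "length (open_blocks [] Q)"
  have "d \<noteq> [] \<Longrightarrow> rename Q (hd d) = Suc (nblocks Q) \<longleftrightarrow> hd d = Suc ?c"
    using rename_eq_iff[of "hd d" "Suc ?c" Q] rename_gt[of Q "Suc ?c"] assms(1) by simp
  then show ?thesis
    using contains_filter_rename[OF assms(1), of Q 0 p] contains_filter_rename[OF assms(1), of Q 1 p]
      assms(2) nc_extends_canonical_stack[OF assms(1), of Q]
    by (auto simp: ncomp_eq_open_blocks right_context_def marked_split_def right_fill_def noncrossing_append
        hd_map)
qed

lemma right_fill: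
  assumes "noncrossing Q" "right_context p d (ncomp Q)"
  shows "noncrossing (right_fill d Q)" "marked_split p Q (map (rename Q) d)"
    "ncomp (right_fill d Q) = length (open_blocks (canonical_stack (ncomp Q)) d)"
proof -
  note pos = right_context_pos[OF assms(2)]
  show nc: "noncrossing (right_fill d Q)" "marked_split p Q (map (rename Q) d)"
    using marked_split_rename[OF pos assms(1)] assms(2) by auto
  show "ncomp (right_fill d Q) = length (open_blocks (canonical_stack (ncomp Q)) d)"
    using open_blocks_rename[OF _ pos, of "canonical_stack (ncomp Q)" Q] canonical_stack_bounds
      map_rename_canonical_stack[of Q]
    unfolding ncomp_eq_open_blocks[OF nc(1)]
    by (simp add: right_fill_def open_blocks_append ncomp_eq_open_blocks[OF assms(1)])
qed

lemma right_fill_exists: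
  assumes "noncrossing w" "contains w p" "p \<noteq> []"
  obtains d Q where "w = right_fill d Q" "noncrossing Q" "right_context p d (ncomp Q)"
proof -
  obtain Q S where QS: "w = Q @ S" "marked_split p Q S"
    using marked_split_exists[OF _ assms(2,3)] assms(1) unfolding noncrossing_def by metis
  have Q: "noncrossing Q" and S: "nc_extends (open_blocks [] Q) (nblocks Q) S"
    using assms(1) QS(1) by (auto simp: noncrossing_append)
  have "\<exists>d. (\<forall>x\<in>set d. 0 < x) \<and> S = map (rename Q) d"
  proof -
    have "\<forall>y\<in>set S. \<exists>x>0. y = rename Q x" using nc_extends_letters[OF S] rename_surj by metis
    then show ?thesis
    proof (induction S)
      case (Cons y S)
      then obtain d x where "\<forall>x\<in>set d. 0 < x" "S = map (rename Q) d" "x > 0" "y = rename Q x" by auto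
      then show ?case by (intro exI[of _ "x # d"]) simp
    qed simp
  qed
  then obtain d where d: "\<forall>x\<in>set d. 0 < x" "S = map (rename Q) d" by blast
  then have "w = right_fill d Q" using QS(1) by (simp add: right_fill_def)
  then show thesis using that marked_split_rename[OF d(1) Q, of p] Q QS(2) assms(1) d(2) by blast
qed

lemma right_fill_inject:
  assumes "noncrossing Q" "right_context p d (ncomp Q)"
    "noncrossing Q'" "right_context p d' (ncomp Q')" "right_fill d Q = right_fill d' Q'"
  shows "d = d' \<and> Q = Q'"
proof -
  have Q: "Q = Q'"
    using marked_split_unique[OF right_fill(2)[OF assms(1,2)] right_fill(2)[OF assms(3,4)]] assms(5)
    by (simp add: right_fill_def)
  then have "map (rename Q) d = map (rename Q) d'" using assms(5) by (simp add: right_fill_def)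
  moreover have "inj_on (rename Q) (set d \<union> set d')"
    using right_context_pos[OF assms(2)] right_context_pos[OF assms(4)]
    by (auto simp: inj_on_def rename_eq_iff)
  ultimately show ?thesis using Q by (simp add: inj_on_map_eq_map)
qed

lemma cc_equiv_pcomp_right:
  assumes "cc_equiv \<rho> \<rho>'" "is_partition \<tau>"
  shows "cc_equiv (pcomp \<rho> \<tau>) (pcomp \<rho>' \<tau>)"
proof (cases "\<tau> = []")
  case False
  have contains: "contains (right_fill d Q) (pcomp r \<tau>) \<longleftrightarrow> contains Q r"
    if "noncrossing Q" "right_context \<tau> d (ncomp Q)" for d Q r
    using contains_pcomp_marked_split[OF _ right_fill(2)[OF that] assms(2) False] right_fill(1)[OF that]
    by (simp add: right_fill_def)
  show ?thesis
  proof (rule cc_equiv_in_context[where F = right_fill and V = "right_context \<tau>" and X = "Av_nc \<tau>"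
        and g = "\<lambda>r. pcomp r \<tau>", OF assms(1)])
    fix r
    show "Av_nc (pcomp r \<tau>) =
      Av_nc \<tau> \<union> (\<lambda>(d, Q). right_fill d Q) ` {(d, Q). Q \<in> Av_nc r \<and> right_context \<tau> d (ncomp Q)}" (is "_ = ?R")
    proof
      show "Av_nc (pcomp r \<tau>) \<subseteq> ?R"
      proof
        fix w assume w: "w \<in> Av_nc (pcomp r \<tau>)"
        show "w \<in> ?R"
        proof (cases "contains w \<tau>")
          case True
          then obtain d Q where q: "w = right_fill d Q" "noncrossing Q" "right_context \<tau> d (ncomp Q)"
            using right_fill_exists[OF _ True False] w unfolding Av_nc_iff by metis
          then have "Q \<in> Av_nc r" using contains[OF q(2,3)] w by (auto simp: Av_nc_iff)
          then show ?thesis using q by (auto intro!: image_eqI[of _ _ "(d, Q)"])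
        qed (use w in \<open>simp add: Av_nc_iff\<close>)
      qed
      show "?R \<subseteq> Av_nc (pcomp r \<tau>)"
        using Av_nc_pcomp_rightI[OF assms(2)] right_fill(1) contains by (auto simp: Av_nc_iff)
    qed
  next
    fix d Q assume "noncrossing Q" "right_context \<tau> d (ncomp Q)"
    then have "contains (filter (\<lambda>x. nblocks Q < x) (map (rename Q) d)) \<tau>"
      using right_fill(2) by (auto simp: marked_split_def)
    then have "contains (map (rename Q) d) \<tau>" using contains_subseq subseq_filter_left by blast
    then have "contains (right_fill d Q) \<tau>"
      using contains_subseq unfolding right_fill_def by (metis list_emb_append2 subseq_order.refl)
    then show "right_fill d Q \<notin> Av_nc \<tau>" by (simp add: Av_nc_iff)
  next
    fix d Q d' Q'
    assume "noncrossing Q" "right_context \<tau> d (ncomp Q)" "noncrossing Q'" "right_context \<tau> d' (ncomp Q')"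
      "right_fill d Q = right_fill d' Q'"
    then show "d = d' \<and> Q = Q'" by (rule right_fill_inject)
  next
    fix d Q Q'
    assume "noncrossing Q" "noncrossing Q'" "right_context \<tau> d (ncomp Q)" "length Q = length Q'" "ncomp Q = ncomp Q'"
    then show "length (right_fill d Q) = length (right_fill d Q') \<and> ncomp (right_fill d Q) = ncomp (right_fill d Q')"
      using right_fill(3)[of Q \<tau> d] right_fill(3)[of Q' \<tau> d] by (simp add: right_fill_def)
  qed
qed (use assms in simp)

theorem theorem3p2:
  fixes \<sigma> \<tau> \<rho> \<rho>' :: "nat list"
  assumes "noncrossing \<sigma>" and "noncrossing \<tau>"
    and "noncrossing \<rho>" and "noncrossing \<rho>'"
    and "cc_equiv \<rho> \<rho>'"
  shows "cc_equiv (pcomp (pcomp \<sigma> \<rho>) \<tau>) (pcomp (pcomp \<sigma> \<rho>') \<tau>)"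
  using assms by (intro cc_equiv_pcomp_right cc_equiv_pcomp_left) (auto simp: noncrossing_def)

end
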